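(* Let $n,r$ be integers with $1\le r<n$, let $q$ be a prime power such that $GF(q)$ contains a primitive $n$-th root of unity $\omega$, and let $F_n=(\omega^{ij})_{0\le i,j\le n-1}$ be the Fourier $n\times n$ matrix relative to $\omega$, with rows $e_0,e_1,\dots,e_{n-1}$ in order. Let $\mathcal{C}=\langle e_0,e_1,\dots,e_{r-1}\rangle$ and $\mathcal{D}=\langle e_{n-r+1},e_{n-r+2},\dots,e_{n-1},e_0\rangle$ be the linear codes over $GF(q)$ spanned by the indicated rows. Then the CSS-type EAQECC construction (recalled in the context), applied to $\mathcal{C}$ and $\mathcal{D}$, yields a maximum-entanglement entanglement-assisted quantum error-correcting code with parameters $[[n,\,2r-n+c,\,d;\,c]]_q$, where $d=n-r+1$ and $c=n-r$.
   Context: A primitive $n$-th root of unity in a field is an element $\omega$ with $\omega^n=1$ and $\omega^j\ne 1$ for $1\le j<n$; its existence in a field $F$ implies that the characteristic of $F$ does not divide $n$. An $[n,k,d]_q$ linear code is a $k$-dimensional subspace of $GF(q)^n$ with minimum Hamming distance $d$. A check matrix of such a code is an $(n-k)\times n$ matrix $H$ of rank $n-k$ over $GF(q)$ such that the code equals $\{x\in GF(q)^n : Hx^{T}=0\}$. Entanglement-assisted quantum error-correcting code (EAQECC): an $[[n,k,d;c]]_q$ EAQECC encodes $k$ qudits of dimension $q$ into $n$ channel qudits, using $c$ maximally entangled pairs of qudits shared in advance between sender and receiver; the receiver's $c$ halves are error-free. Formally, there is an isometry $U:(\mathbb{C}^q)^{\otimes k}\otimes(\mathbb{C}^q)^{\otimes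 c}\to(\mathbb{C}^q)^{\otimes n}$ and the code space is $\{(U\otimes I_B)(\psi\otimes\Phi):\psi\in(\mathbb{C}^q)^{\otimes k}\}\subseteq(\mathbb{C}^q)^{\otimes n}\otimes(\mathbb{C}^q)^{\otimes c}_B$, where $\Phi\in(\mathbb{C}^q)^{\otimes c}\otimes(\mathbb{C}^q)^{\otimes c}_B$ is the state of $c$ maximally entangled pairs. With $P$ the orthogonal projector onto the code space, having distance $d$ (in the usual sense of guaranteed distance) means that for every operator $E$ on $(\mathbb{C}^q)^{\otimes n}$ acting nontrivially on at most $d-1$ of the $n$ channel qudits, $P(E\otimes I_B)P=\lambda_E P$ for some scalar $\lambda_E$. The code has maximum entanglement if $c=n-k$. CSS-type EAQECC construction (previously known): if $\mathcal{C}$ and $\mathcal{D}$ are $[n,k_1,d_1]_q$ and $[n,k_2,d_2]_q$ linear codes with check matrices $H$ and $K$ respectively, then an $[[n,\,k_1+k_2-n+c,\,\min\{d_1,d_2\};\,c]]_q$ EAQECC can be constructed, where $c=\operatorname{rank}(HK^{T})$. *)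

theory Defs
  imports
    Complex_Main
    "HOL-Library.Cardinality"
    "HOL-Number_Theory.Prime_Powers"
    "Jordan_Normal_Form.Matrix_Kernel"
    "Jordan_Normal_Form.DL_Rank"
begin

(* GF(q) is an arbitrary finite field type 'a with CARD('a) = q. *)

section \<open>Linear codes\<close>

definition primitive_root_of_unity :: "nat \<Rightarrow> 'a::field \<Rightarrow> bool" where
  "primitive_root_of_unity n \<omega> \<longleftrightarrow> \<omega> ^ n = 1 \<and> (\<forall>j. 1 \<le> j \<and> j < n \<longrightarrow> \<omega> ^ j \<noteq> 1)"

definition fourier_mat :: "nat \<Rightarrow> 'a::field \<Rightarrow> 'a mat" where
  "fourier_mat n \<omega> = mat n n (\<lambda>(i, j). \<omega> ^ (i * j))"

definition hamming_dist :: "'a vec \<Rightarrow> 'a vec \<Rightarrow> nat" where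
  "hamming_dist x y = card {i. i < dim_vec x \<and> x $ i \<noteq> y $ i}"

definition is_min_distance :: "nat \<Rightarrow> 'a vec set \<Rightarrow> bool" where
  "is_min_distance d C \<longleftrightarrow>
     (\<exists>x\<in>C. \<exists>y\<in>C. x \<noteq> y \<and> hamming_dist x y = d) \<and>
     (\<forall>x\<in>C. \<forall>y\<in>C. x \<noteq> y \<longrightarrow> d \<le> hamming_dist x y)"

definition linear_code :: "nat \<Rightarrow> nat \<Rightarrow> nat \<Rightarrow> 'a::field vec set \<Rightarrow> bool" where
  "linear_code n k d C \<longleftrightarrow>
     VectorSpace.subspace class_ring C (module_vec TYPE('a) n) \<and>
     vectorspace.dim (class_ring :: 'a ring) ((module_vec TYPE('a) n)\<lparr>carrier := C\<rparr>) = k \<and>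
     is_min_distance d C"

definition check_matrix :: "nat \<Rightarrow> nat \<Rightarrow> 'a::field mat \<Rightarrow> 'a vec set \<Rightarrow> bool" where
  "check_matrix n k H C \<longleftrightarrow>
     H \<in> carrier_mat (n - k) n \<and> vec_space.rank (n - k) H = n - k \<and> C = mat_kernel H"

section \<open>States and operators\<close>

(* The Hilbert space with orthonormal basis (|b>) for b in a finite set B consists of the complex
   functions vanishing off B.  The basis of the n-fold tensor power of C^q is labelled by the
   words carrier_vec n over the q-element alphabet 'a, and a tensor product of two spaces has the
   product of the two basis sets as its basis.  An operator is given by its matrix entries
   M x y = <x|M|y>. *)

definition states :: "'b set \<Rightarrow> ('b \<Rightarrow> complex) set" where
  "states B = {v. \<forall>x. x \<notin> B \<longrightarrow> v x = 0}"

definition apply_op :: "'b set \<Rightarrow> ('b \<Rightarrow> 'b \<Rightarrow> complex) \<Rightarrow> ('b \<Rightarrow> complex) \<Rightarrow> ('b \<Rightarrow> complex)" where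
  "apply_op B M v = (\<lambda>x. if x \<in> B then \<Sum>y\<in>B. M x y * v y else 0)"

definition is_isometry :: "'b set \<Rightarrow> 'c set \<Rightarrow> ('c \<Rightarrow> 'b \<Rightarrow> complex) \<Rightarrow> bool" where
  "is_isometry B B' U \<longleftrightarrow>
     (\<forall>a\<in>B. \<forall>b\<in>B. (\<Sum>x\<in>B'. cnj (U x a) * U x b) = (if a = b then 1 else 0))"

definition is_orthogonal_projector ::
    "'b set \<Rightarrow> ('b \<Rightarrow> complex) set \<Rightarrow> ('b \<Rightarrow> 'b \<Rightarrow> complex) \<Rightarrow> bool" where
  "is_orthogonal_projector B Q P \<longleftrightarrow>
     (\<forall>x\<in>B. \<forall>y\<in>B. P x y = cnj (P y x)) \<and>
     (\<forall>v\<in>states B. apply_op B P v \<in> Q) \<and>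
     (\<forall>v\<in>Q. apply_op B P v = v)"

(* E is a tensor product of an operator G on the qudits in S and the identity on the others. *)
definition acts_only_on ::
    "nat \<Rightarrow> nat set \<Rightarrow> ('a vec \<Rightarrow> 'a vec \<Rightarrow> complex) \<Rightarrow> bool" where
  "acts_only_on n S E \<longleftrightarrow>
     (\<exists>G. \<forall>x\<in>carrier_vec n. \<forall>y\<in>carrier_vec n.
        E x y = (if \<forall>i<n. i \<notin> S \<longrightarrow> x $ i = y $ i
                 then G (restrict (($) x) S) (restrict (($) y) S) else 0))"

definition tensor_id :: "('b \<Rightarrow> 'b \<Rightarrow> complex) \<Rightarrow> ('b \<times> 'c \<Rightarrow> 'b \<times> 'c \<Rightarrow> complex)" where
  "tensor_id E = (\<lambda>(x, t) (y, u). E x y * (if t = u then 1 else 0))"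

section \<open>Entanglement-assisted codes\<close>

(* Basis of the sender's n channel qudits together with the receiver's c halves of the pairs. *)
abbreviation ea_basis :: "nat \<Rightarrow> nat \<Rightarrow> ('a vec \<times> 'a vec) set" where
  "ea_basis n c \<equiv> carrier_vec n \<times> carrier_vec c"

(* Each of the c pairs is in the state sum_a |a>|a> / sqrt q. *)
definition max_entangled_state :: "nat \<Rightarrow> ('a::finite vec \<times> 'a vec) \<Rightarrow> complex" where
  "max_entangled_state c = (\<lambda>(s, t). if (s, t) \<in> ea_basis c c
     then \<Prod>i<c. (if s $ i = t $ i then complex_of_real (1 / sqrt (real CARD('a))) else 0) else 0)"

(* The vector (U \<otimes> I)(\<psi> \<otimes> \<Phi>). *)
definition ea_encode ::
    "nat \<Rightarrow> nat \<Rightarrow> nat \<Rightarrow> ('a::finite vec \<Rightarrow> 'a vec \<times> 'a vec \<Rightarrow> complex)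
      \<Rightarrow> ('a vec \<Rightarrow> complex) \<Rightarrow> ('a vec \<times> 'a vec \<Rightarrow> complex)" where
  "ea_encode n k c U \<psi> = (\<lambda>(x, t). if (x, t) \<in> ea_basis n c
     then \<Sum>(m, s)\<in>carrier_vec k \<times> carrier_vec c. U x (m, s) * (\<psi> m * max_entangled_state c (s, t))
     else 0)"

definition has_distance ::
    "nat \<Rightarrow> nat \<Rightarrow> nat \<Rightarrow> ('a::finite vec \<times> 'a vec \<Rightarrow> complex) set \<Rightarrow> bool" where
  "has_distance n c d Q \<longleftrightarrow>
     (\<exists>P. is_orthogonal_projector (ea_basis n c) Q P \<and>
        (\<forall>S E. S \<subseteq> {..<n} \<and> card S < d \<and> acts_only_on n S E \<longrightarrow>
           (\<exists>\<mu>. \<forall>v\<in>states (ea_basis n c).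
              apply_op (ea_basis n c) P (apply_op (ea_basis n c) (tensor_id E)
                (apply_op (ea_basis n c) P v))
              = (\<lambda>z. \<mu> * apply_op (ea_basis n c) P v z))))"

(* Q is the code space of an [[n, k, d; c]]_q code, q = CARD('a). *)
definition is_eaqecc ::
    "nat \<Rightarrow> nat \<Rightarrow> nat \<Rightarrow> nat \<Rightarrow> ('a::finite vec \<times> 'a vec \<Rightarrow> complex) set \<Rightarrow> bool" where
  "is_eaqecc n k d c Q \<longleftrightarrow>
     (\<exists>U. is_isometry (carrier_vec k \<times> carrier_vec c) (carrier_vec n) U \<and>
          Q = ea_encode n k c U ` states (carrier_vec k)) \<and>
     has_distance n c d Q"

definition maximum_entanglement :: "nat \<Rightarrow> nat \<Rightarrow> nat \<Rightarrow> bool" where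
  "maximum_entanglement n k c \<longleftrightarrow> int c = int n - int k"

section \<open>The CSS-type construction\<close>

definition additive_character :: "('a::field \<Rightarrow> complex) \<Rightarrow> bool" where
  "additive_character \<chi> \<longleftrightarrow> \<chi> 0 = 1 \<and> (\<forall>x y. \<chi> (x + y) = \<chi> x * \<chi> y)"

(* |x>|t> is sent to |x + a>|t + a'>. *)
definition X_op ::
    "nat \<Rightarrow> nat \<Rightarrow> 'a::field vec \<Rightarrow> 'a vec
      \<Rightarrow> ('a vec \<times> 'a vec \<Rightarrow> complex) \<Rightarrow> ('a vec \<times> 'a vec \<Rightarrow> complex)" where
  "X_op n c a a' v = (\<lambda>(x, t). if (x, t) \<in> ea_basis n c then v (x - a, t - a') else 0)"

(* |x>|t> is sent to \<chi>(b.x + b'.t) |x>|t>. *)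
definition Z_op ::
    "nat \<Rightarrow> nat \<Rightarrow> ('a::field \<Rightarrow> complex) \<Rightarrow> 'a vec \<Rightarrow> 'a vec
      \<Rightarrow> ('a vec \<times> 'a vec \<Rightarrow> complex) \<Rightarrow> ('a vec \<times> 'a vec \<Rightarrow> complex)" where
  "Z_op n c \<chi> b b' v =
     (\<lambda>(x, t). if (x, t) \<in> ea_basis n c then \<chi> (b \<bullet> x + b' \<bullet> t) * v (x, t) else 0)"

(* The X-type stabilizers come from the row space of H, the Z-type ones from the row space of K;
   A and B extend them to the receiver's c qudits so that all of them commute, which for the
   extended check matrices [H | A] and [K | B] means H K^T + A B^T = 0.  The usual fixed character
   \<chi>(x) = exp(2 \<pi> i tr(x) / p) gives the same code: every additive character has the form
   x \<mapsto> \<chi>(a x), and w ranges over a space closed under multiplication by a. *)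
definition css_code_space ::
    "nat \<Rightarrow> nat \<Rightarrow> 'a::field mat \<Rightarrow> 'a mat \<Rightarrow> 'a mat \<Rightarrow> 'a mat
      \<Rightarrow> ('a vec \<times> 'a vec \<Rightarrow> complex) set" where
  "css_code_space n c H K A B = {v \<in> states (ea_basis n c).
     (\<forall>u\<in>carrier_vec (dim_row H). X_op n c (H\<^sup>T *\<^sub>v u) (A\<^sup>T *\<^sub>v u) v = v) \<and>
     (\<forall>w\<in>carrier_vec (dim_row K). \<forall>\<chi>. additive_character \<chi> \<longrightarrow>
        Z_op n c \<chi> (K\<^sup>T *\<^sub>v w) (B\<^sup>T *\<^sub>v w) v = v)}"

definition css_construction ::
    "nat \<Rightarrow> nat \<Rightarrow> 'a::field mat \<Rightarrow> 'a mat \<Rightarrow> ('a vec \<times> 'a vec \<Rightarrow> complex) set \<Rightarrow> bool" where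
  "css_construction n c H K Q \<longleftrightarrow>
     (\<exists>A B. A \<in> carrier_mat (dim_row H) c \<and> B \<in> carrier_mat (dim_row K) c \<and>
        H * K\<^sup>T + A * B\<^sup>T = 0\<^sub>m (dim_row H) (dim_row K) \<and>
        Q = css_code_space n c H K A B)"

end

(* The codes are generalized Reed-Solomon codes: with RS(s, k) = {(\<omega>^(s j) f(\<omega>^j))_j : deg f < k} one has
   C = RS(0, r) and D = RS(n-r+1, r), and RS(s, k) is dual to RS(s', n-k) when s + s' \<equiv> 1 (mod n).
   If H and K are check matrices, then the words H^T u fill RS(1, n-r), which pairs perfectly with
   the row space of K, so H K^T is invertible.

   Take A = 1 and B = -K H^T.  The X-stabilizers force v(x, t) = f(x - H^T t), and the Z-stabilizers
   force f to vanish outside D, because additive characters separate the points of the field.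
   Since every word is uniquely z + H^T t with z in D, the encoder |m>|s> -> |g(m) + H^T s>, for a
   bijection g onto D, is an isometry with this code space as its image.

   For an error E on a set S of at most n-r qudits, P (E \<otimes> I) P has the matrix entries
   q^(-c) \<Sum>_u E(z + H^T u, z' + H^T u) with z, z' in D.  They vanish for z \<noteq> z' because z - z' would be
   a word of D of weight at most n-r, and for z = z' they do not depend on z because the restrictions
   of the words H^T u to S are arbitrary, so u can be shifted to remove z. *)
theory Submission
  imports Defs "HOL-Computational_Algebra.Polynomial" "HOL-Number_Theory.Cong"
begin

section \<open>Generalized Reed-Solomon codes on the powers of a root of unity\<close>

lemma poly_eq_sum_lessThan:
  fixes p :: "'a::comm_semiring_1 poly"
  assumes "degree p < n"
  shows "poly p x = (\<Sum>l<n. coeff p l * x ^ l)"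
  unfolding poly_altdef
  by (rule sum.mono_neutral_left) (use assms in \<open>auto simp: coeff_eq_0\<close>)

lemma degree_prod_roots:
  fixes S :: "'a::idom set"
  assumes "finite S"
  shows "degree (\<Prod>a\<in>S. [:-a, 1:]) = card S"
proof -
  have "degree (\<Prod>a\<in>S. [:-a, 1:]) = (\<Sum>a\<in>S. degree [:-a, 1:])"
    by (rule degree_prod_eq_sum_degree) auto
  then show ?thesis
    by simp
qed

lemma poly_prod_roots_eq_0_iff:
  fixes S :: "'a::idom set"
  assumes "finite S"
  shows "poly (\<Prod>a\<in>S. [:-a, 1:]) x = 0 \<longleftrightarrow> x \<in> S"
  using assms by (auto simp: poly_prod)

text \<open>Newton's scheme: the interpolant on the old nodes is corrected by a multiple of the
  product that vanishes on all of them. The degree bound is guarded because no degree lies below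
  \<open>card {}\<close>.\<close>

lemma exists_interpolating_poly:
  fixes g :: "'a::field \<Rightarrow> 'a"
  assumes "finite S"
  shows "\<exists>p. (S \<noteq> {} \<longrightarrow> degree p < card S) \<and> (\<forall>a\<in>S. poly p a = g a)"
  using assms
proof (induction S rule: finite_induct)
  case (insert b S)
  then obtain p where p: "S \<noteq> {} \<longrightarrow> degree p < card S" "\<forall>a\<in>S. poly p a = g a"
    by blast
  let ?w = "\<Prod>a\<in>S. [:-a, 1:]"
  have w: "degree ?w = card S" "poly ?w b \<noteq> 0" "\<And>a. a \<in> S \<Longrightarrow> poly ?w a = 0"
    using insert.hyps by (simp_all only: degree_prod_roots poly_prod_roots_eq_0_iff) auto
  show ?case
  proof (cases "S = {}")
    case True
    show ?thesis
      by (rule exI[of _ "[:g b:]"]) (simp add: True)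
  next
    case False
    let ?c = "(g b - poly p b) / poly ?w b"
    have "degree (p + Polynomial.smult ?c ?w) < card (insert b S)"
      using p(1) False w(1) insert.hyps
      by (intro degree_add_less) (auto intro: le_less_trans[OF Polynomial.degree_smult_le])
    moreover have "poly (p + Polynomial.smult ?c ?w) a = g a" if "a \<in> insert b S" for a
      using that p(2) w insert.hyps by auto
    ultimately show ?thesis
      by blast
  qed
qed auto

section \<open>Powers of a primitive root of unity\<close>

locale primitive_root =
  fixes n :: nat and \<omega> :: "'a::field"
  assumes n_pos: "0 < n" and primitive: "primitive_root_of_unity n \<omega>"
begin

lemma root_power_n: "\<omega> ^ n = 1"
  using primitive by (simp add: primitive_root_of_unity_def)

lemma root_nonzero: "\<omega> \<noteq> 0"
  using root_power_n n_pos by (auto simp: power_0_left)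

lemma root_power_mod: "\<omega> ^ (j mod n) = \<omega> ^ j"
proof -
  have "\<omega> ^ j = \<omega> ^ (n * (j div n) + j mod n)"
    by simp
  also have "\<dots> = \<omega> ^ (j mod n)"
    by (simp only: power_add power_mult root_power_n power_one mult_1)
  finally show ?thesis ..
qed

lemma root_power_eq_1_iff: "\<omega> ^ j = 1 \<longleftrightarrow> n dvd j"
proof
  assume "\<omega> ^ j = 1"
  then have "\<omega> ^ (j mod n) = 1"
    by (simp add: root_power_mod)
  then have "\<not> (1 \<le> j mod n \<and> j mod n < n)"
    using primitive unfolding primitive_root_of_unity_def by blast
  then show "n dvd j"
    using n_pos by (auto simp: dvd_eq_mod_eq_0)
qed (auto simp: root_power_mod[of j, symmetric])

lemma inj_on_root_power: "inj_on (\<lambda>j. \<omega> ^ j) {..<n}"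
proof (rule linorder_inj_onI)
  fix i j assume ij: "i < j" "i \<in> {..<n}" "j \<in> {..<n}"
  have "\<omega> ^ j = \<omega> ^ i * \<omega> ^ (j - i)"
    using ij by (simp flip: power_add)
  moreover have "\<omega> ^ (j - i) \<noteq> 1"
    using ij by (auto simp: root_power_eq_1_iff dest: dvd_imp_le)
  ultimately show "\<omega> ^ i \<noteq> \<omega> ^ j"
    using root_nonzero by simp
qed auto

text \<open>Geometric series with ratio \<omega>^i: the numerator \<omega>^(i n) - 1 of its closed
  form is 0, and the ratio is 1 exactly when n divides i.\<close>

lemma sum_root_powers: "(\<Sum>j<n. \<omega> ^ (i * j)) = (if n dvd i then of_nat n else 0)"
proof (cases "n dvd i")
  case True
  then have "\<omega> ^ (i * j) = 1" for j
    by (simp add: root_power_eq_1_iff)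
  then show ?thesis
    using True by simp
next
  case False
  have "(\<omega> ^ i - 1) * (\<Sum>j<n. (\<omega> ^ i) ^ j) = (\<omega> ^ i) ^ n - 1"
    by (simp add: power_diff_1_eq)
  also have "\<dots> = 0"
    by (simp add: root_power_eq_1_iff flip: power_mult)
  finally show ?thesis
    using False root_power_eq_1_iff[of i] by (simp add: power_mult)
qed

section \<open>Evaluation codes and their duals\<close>

definition eval_vec :: "nat \<Rightarrow> 'a poly \<Rightarrow> 'a vec" where
  "eval_vec s p = vec n (\<lambda>j. \<omega> ^ (s * j) * poly p (\<omega> ^ j))"

text \<open>The multiplier \<omega>^(s j) turns the monomial of degree i into row s + i (mod n) of
  the Fourier matrix, so k cyclically consecutive rows from row s on span this code. For k = 0 the
  set is empty instead of the zero code, hence the assumptions \<open>0 < k\<close> below.\<close>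

definition rs_code :: "nat \<Rightarrow> nat \<Rightarrow> 'a vec set" where
  "rs_code s k = eval_vec s ` {p. degree p < k}"

lemma eval_vec_carrier [simp]: "eval_vec s p \<in> carrier_vec n"
  by (simp add: eval_vec_def)

lemma dim_eval_vec [simp]: "dim_vec (eval_vec s p) = n"
  by (simp add: eval_vec_def)

lemma eval_vec_index [simp]: "j < n \<Longrightarrow> eval_vec s p $ j = \<omega> ^ (s * j) * poly p (\<omega> ^ j)"
  by (simp add: eval_vec_def)

lemma eval_vec_diff: "eval_vec s (p - p') = eval_vec s p - eval_vec s p'"
  by (rule eq_vecI) (auto simp: algebra_simps)

lemma eval_vec_0: "eval_vec s 0 = 0\<^sub>v n"
  by (rule eq_vecI) auto

text \<open>Discrete Fourier inversion: the sum over all positions keeps only the coefficients whose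
  index m makes s' + i + s + m divisible by n, and l is the only such index below n.\<close>

lemma eval_vec_monom_scalar_prod:
  assumes "degree p < n" "l < n" "n dvd s' + i + s + l"
  shows "eval_vec s' (monom 1 i) \<bullet> eval_vec s p = of_nat n * coeff p l"
proof -
  have dvd: "n dvd s' + i + s + m \<longleftrightarrow> m = l" if "m < n" for m
  proof
    assume m: "n dvd s' + i + s + m"
    have "cong (s' + i + s + m) (s' + i + s + l) n"
      using m assms(3) by (simp add: cong_def)
    then have "cong m l n"
      by (simp add: cong_add_lcancel_nat)
    then show "m = l"
      using that assms(2) by (simp add: cong_def)
  qed (use assms in simp)
  have "eval_vec s' (monom 1 i) \<bullet> eval_vec s p
      = (\<Sum>j<n. \<omega> ^ (s' * j) * \<omega> ^ (i * j) * (\<omega> ^ (s * j) * (\<Sum>m<n. coeff p m * \<omega> ^ (m * j))))"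
    unfolding scalar_prod_def
    by (simp add: poly_monom poly_eq_sum_lessThan[OF assms(1)] atLeast0LessThan mult.commute
        flip: power_mult)
  also have "\<dots> = (\<Sum>j<n. \<Sum>m<n. coeff p m * \<omega> ^ ((s' + i + s + m) * j))"
    by (simp add: sum_distrib_left power_add algebra_simps)
  also have "\<dots> = (\<Sum>m<n. coeff p m * (\<Sum>j<n. \<omega> ^ ((s' + i + s + m) * j)))"
    by (subst sum.swap) (simp add: sum_distrib_left)
  also have "\<dots> = (\<Sum>m<n. if m = l then coeff p m * of_nat n else 0)"
    by (rule sum.cong) (simp_all add: sum_root_powers dvd)
  also have "\<dots> = of_nat n * coeff p l"
    using assms(2) by simp
  finally show ?thesis .
qed

(* Pairing the all-ones vector with a polynomial vanishing at every power except 1. *)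
lemma of_nat_n_nonzero: "(of_nat n :: 'a) \<noteq> 0"
proof
  assume n0: "(of_nat n :: 'a) = 0"
  let ?S = "(\<lambda>j. \<omega> ^ j) ` {1..<n}"
  let ?p = "\<Prod>a\<in>?S. [:-a, 1:]"
  have "card ?S \<le> n - 1"
    using card_image_le[of "{1..<n}" "\<lambda>j. \<omega> ^ j"] by simp
  then have deg: "degree ?p < n"
    using n_pos by (simp add: degree_prod_roots)
  have "(\<Sum>j<n. poly ?p (\<omega> ^ j)) = eval_vec 0 (monom 1 0) \<bullet> eval_vec 0 ?p"
    unfolding scalar_prod_def by (simp add: atLeast0LessThan monom_0)
  also have "\<dots> = 0"
    using eval_vec_monom_scalar_prod[OF deg, of 0 0 0 0] n_pos n0 by simp
  finally have "(\<Sum>j<n. poly ?p (\<omega> ^ j)) = 0" .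
  moreover have "(\<Sum>j<n. poly ?p (\<omega> ^ j)) = (\<Sum>j\<in>{0}. poly ?p (\<omega> ^ j))"
    using n_pos by (intro sum.mono_neutral_right) (auto simp: poly_prod_roots_eq_0_iff Suc_le_eq)
  \<comment> \<open>Only the term j = 0 is left of the sum, so \<open>?p\<close> vanishes at 1 as
    well; but its roots are the powers \<omega>^j with 0 < j < n.\<close>
  ultimately have "1 \<in> ?S"
    using poly_prod_roots_eq_0_iff[of ?S 1] by simp
  then show False
    by (auto simp: root_power_eq_1_iff dest!: sym[of 1] dvd_imp_le)
qed

text \<open>The multipliers are nonzero and the evaluation points distinct, so zero entries give
  distinct roots of p.\<close>

lemma eval_vec_zeros:
  assumes "p \<noteq> 0"
  shows "card {j. j < n \<and> eval_vec s p $ j = 0} \<le> degree p"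
proof -
  let ?Z = "{j. j < n \<and> eval_vec s p $ j = 0}"
  have "card ?Z = card ((\<lambda>j. \<omega> ^ j) ` ?Z)"
    by (rule card_image[symmetric]) (rule inj_on_subset[OF inj_on_root_power], auto)
  also have "\<dots> \<le> card {x. poly p x = 0}"
    using assms root_nonzero by (intro card_mono poly_roots_finite) auto
  also have "\<dots> \<le> degree p"
    by (rule card_poly_roots_bound[OF assms])
  finally show ?thesis .
qed

lemma inj_on_eval_vec: "inj_on (eval_vec s) {p. degree p < n}"
proof (rule inj_onI, rule ccontr)
  fix p p' assume p: "p \<in> {p. degree p < n}" "p' \<in> {p. degree p < n}"
    and eq: "eval_vec s p = eval_vec s p'" and "p \<noteq> p'"
  have "{j. j < n \<and> eval_vec s (p - p') $ j = 0} = {..<n}"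
    using eq by (auto simp: eval_vec_diff)
  then have "n \<le> degree (p - p')"
    using eval_vec_zeros[of "p - p'" s] \<open>p \<noteq> p'\<close> by simp
  moreover have "degree (p - p') < n"
    using p by (intro degree_diff_less) auto
  ultimately show False
    by simp
qed

text \<open>Interpolation at the distinct points \<omega>^j, after dividing the wanted values by the
  multipliers. This freedom on small sets of positions later removes a codeword from the diagonal
  entries of an error.\<close>

lemma exists_eval_vec_on:
  assumes S: "S \<subseteq> {..<n}" and k: "card S \<le> k" "0 < k"
  shows "\<exists>y\<in>rs_code s k. \<forall>j\<in>S. y $ j = z j"
proof -
  have fin: "finite S"
    using S finite_subset by blast
  have inj: "inj_on (\<lambda>j. \<omega> ^ j) S"
    using inj_on_root_power S by (rule inj_on_subset)
  define g where "g a = (let j = the_inv_into S (\<lambda>j. \<omega> ^ j) a in z j / \<omega> ^ (s * j))" for a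
  obtain p where p: "(\<lambda>j. \<omega> ^ j) ` S \<noteq> {} \<longrightarrow> degree p < card ((\<lambda>j. \<omega> ^ j) ` S)"
    "\<forall>a\<in>(\<lambda>j. \<omega> ^ j) ` S. poly p a = g a"
    using exists_interpolating_poly[of "(\<lambda>j. \<omega> ^ j) ` S" g] fin by blast
  \<comment> \<open>For empty \<open>S\<close> the interpolation gives no degree bound, so 0 takes
    its place.\<close>
  define p' where "p' = (if S = {} then 0 else p)"
  have "degree p' < k"
    using p(1) k card_image[OF inj] by (auto simp: p'_def)
  moreover have "eval_vec s p' $ j = z j" if "j \<in> S" for j
    using that S p(2) root_nonzero inj by (auto simp: p'_def g_def the_inv_into_f_f)
  ultimately show ?thesis
    unfolding rs_code_def by blast
qed

lemma rs_code_n: "rs_code s n = carrier_vec n"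
proof
  show "carrier_vec n \<subseteq> rs_code s n"
  proof
    fix x :: "'a vec" assume x: "x \<in> carrier_vec n"
    obtain y where y: "y \<in> rs_code s n" "\<forall>j\<in>{..<n}. y $ j = x $ j"
      using exists_eval_vec_on[of "{..<n}" n s "($) x"] n_pos by auto
    then have "y \<in> carrier_vec n"
      by (auto simp: rs_code_def)
    then have "y = x"
      using x y(2) by (intro eq_vecI) auto
    with y(1) show "x \<in> rs_code s n"
      by simp
  qed
qed (auto simp: rs_code_def)

(* The hypothesis on s and s' says s + s' \<equiv> 1 (mod n). *)
lemma rs_code_dual:
  assumes k: "0 < k" "k < n" and s: "n dvd s' + s + (n - 1)"
  shows "rs_code s k
    = {x \<in> carrier_vec n. \<forall>i<n - k. eval_vec s' (monom 1 i) \<bullet> x = 0}"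
proof -
  \<comment> \<open>Test vector i reads off the coefficient of index n - 1 - i, so those with i < n
    - k test exactly the coefficients k, ..., n - 1.\<close>
  have dvd: "n dvd s' + i + s + (n - 1 - i)" if "i < n" for i
  proof -
    have "s' + i + s + (n - 1 - i) = s' + s + (n - 1)"
      using that by simp
    then show ?thesis
      using s by (simp only:)
  qed
  have iff: "degree p < k \<longleftrightarrow> (\<forall>i<n - k. eval_vec s' (monom 1 i) \<bullet> eval_vec s p = 0)"
    if "degree p < n" for p
  proof -
    have "(\<forall>i<n - k. eval_vec s' (monom 1 i) \<bullet> eval_vec s p = 0)
        \<longleftrightarrow> (\<forall>i<n - k. coeff p (n - 1 - i) = 0)"
      using eval_vec_monom_scalar_prod[OF that _ dvd] of_nat_n_nonzero by auto
    also have "\<dots> \<longleftrightarrow> (\<forall>l\<in>{k..<n}. coeff p l = 0)"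
    proof safe
      fix l assume *: "\<forall>i<n - k. coeff p (n - 1 - i) = 0" and "l \<in> {k..<n}"
      then show "coeff p l = 0"
        using *[rule_format, of "n - 1 - l"] by auto
    qed auto
    also have "\<dots> \<longleftrightarrow> (\<forall>l\<ge>k. coeff p l = 0)"
      using that by (auto simp: coeff_eq_0 not_less)
    \<comment> \<open>Positivity of k covers the zero polynomial, whose degree is 0.\<close>
    also have "\<dots> \<longleftrightarrow> degree p < k"
      using k(1) by (metis coeff_eq_0 leading_coeff_0_iff degree_0 less_le_trans not_le)
    finally show ?thesis ..
  qed
  have eq: "carrier_vec n = eval_vec s ` {p. degree p < n}"
    using rs_code_n[of s] by (simp add: rs_code_def)
  show ?thesis
    unfolding eq rs_code_def
  proof (rule subset_antisym; rule subsetI)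
    fix x assume "x \<in> eval_vec s ` {p. degree p < k}"
    then obtain p where p: "x = eval_vec s p" "degree p < k"
      by blast
    with k have "degree p < n"
      by simp
    with p iff[OF this] show "x \<in> {x \<in> eval_vec s ` {p. degree p < n}.
        \<forall>i<n - k. eval_vec s' (monom 1 i) \<bullet> x = 0}"
      by blast
  qed (use iff in blast)
qed

end

section \<open>Parameters and check matrices\<close>

lemma card_carrier_vec: "card (carrier_vec n :: 'a::finite vec set) = CARD('a) ^ n"
proof -
  have "bij_betw list_of_vec (carrier_vec n :: 'a vec set) {xs. set xs \<subseteq> UNIV \<and> length xs = n}"
    by (rule bij_betwI[where g = vec_of_list]) (auto simp: list_vec vec_list intro: carrier_vecI)
  from bij_betw_same_card[OF this] show ?thesis
    using card_lists_length_eq[of "UNIV :: 'a set" n] by simp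
qed

lemma finite_carrier_vec [simp]: "finite (carrier_vec n :: 'a::finite vec set)"
  by (rule card_ge_0_finite) (simp add: card_carrier_vec)

text \<open>Rank-nullity by counting: q^n vectors are spread over fibres of at most q^k elements
  each, so the image has at least q^m elements.\<close>

lemma mult_mat_vec_surj_of_card_kernel:
  fixes A :: "'a::{field, finite} mat"
  assumes A: "A \<in> carrier_mat m n" and card: "card (mat_kernel A) = CARD('a) ^ k"
    and n: "n = k + m"
  shows "(\<lambda>x. A *\<^sub>v x) ` carrier_vec n = carrier_vec m"
proof (rule card_seteq)
  let ?I = "(\<lambda>x. A *\<^sub>v x) ` carrier_vec n"
  show "?I \<subseteq> carrier_vec m"
    using A by auto
  have fibre: "card {x \<in> carrier_vec n. A *\<^sub>v x = y} \<le> card (mat_kernel A)"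
    if "y \<in> ?I" for y
  proof -
    obtain x0 where x0: "x0 \<in> carrier_vec n" "y = A *\<^sub>v x0"
      using \<open>y \<in> ?I\<close> by blast
    \<comment> \<open>Subtracting one fixed preimage carries the fibre into the kernel.\<close>
    have "inj_on (\<lambda>x. x - x0) {x \<in> carrier_vec n. A *\<^sub>v x = y}"
    proof (rule inj_onI)
      fix x x' assume x: "x \<in> {x \<in> carrier_vec n. A *\<^sub>v x = y}" "x' \<in> {x \<in> carrier_vec n. A *\<^sub>v x = y}"
        and eq: "x - x0 = x' - x0"
      have "x = (x - x0) + x0" "x' = (x' - x0) + x0"
        using x x0 by (auto intro!: eq_vecI)
      with eq show "x = x'"
        by simp
    qed
    moreover have "(\<lambda>x. x - x0) ` {x \<in> carrier_vec n. A *\<^sub>v x = y} \<subseteq> mat_kernel A"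
      using A x0 by (auto simp: mat_kernel[OF A] mult_minus_distrib_mat_vec)
    moreover have "finite (mat_kernel A)"
      by (rule finite_subset[OF _ finite_carrier_vec[of n]]) (use A in \<open>auto simp: mat_kernel_def\<close>)
    ultimately show ?thesis
      by (rule card_inj_on_le)
  qed
  have "CARD('a) ^ n = (\<Sum>x\<in>(carrier_vec n :: 'a vec set). 1)"
    by (simp add: card_carrier_vec)
  also have "\<dots> = (\<Sum>y\<in>?I. \<Sum>x\<in>{x \<in> carrier_vec n. A *\<^sub>v x = y}. 1)"
    by (rule sum.image_gen) simp
  also have "\<dots> \<le> (\<Sum>y\<in>?I. CARD('a) ^ k)"
    using fibre by (intro sum_mono) (simp add: card)
  finally have "CARD('a) ^ m * CARD('a) ^ k \<le> card ?I * CARD('a) ^ k"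
    by (simp add: n power_add mult.commute)
  then show "card (carrier_vec m :: 'a vec set) \<le> card ?I"
    by (simp add: card_carrier_vec)
qed simp

text \<open>Each unit vector has the form A x, and pairing it with u gives the entry of u as the
  product of A^T u = 0 with x.\<close>

lemma transpose_mult_vec_eq_0:
  fixes A :: "'a::field mat"
  assumes A: "A \<in> carrier_mat m n" and surj: "(\<lambda>x. A *\<^sub>v x) ` carrier_vec n = carrier_vec m"
    and u: "u \<in> carrier_vec m" "A\<^sup>T *\<^sub>v u = 0\<^sub>v n"
  shows "u = 0\<^sub>v m"
proof (rule eq_vecI)
  fix i assume i: "i < dim_vec (0\<^sub>v m :: 'a vec)"
  then have "unit_vec m i \<in> (\<lambda>x. A *\<^sub>v x) ` carrier_vec n"
    unfolding surj by simp
  then obtain x where x: "x \<in> carrier_vec n" "A *\<^sub>v x = unit_vec m i"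
    by (metis imageE)
  have "u $ i = u \<bullet> (A *\<^sub>v x)"
    using i u x by simp
  also have "\<dots> = (A\<^sup>T *\<^sub>v u) \<bullet> x"
    using transpose_vec_mult_scalar[OF A x(1) u(1)] by simp
  finally show "u $ i = 0\<^sub>v m $ i"
    using i u x by simp
qed (use u in simp)

lemma rank_eq_of_surj:
  fixes A :: "'a::field mat"
  assumes A: "A \<in> carrier_mat m n" and surj: "(\<lambda>x. A *\<^sub>v x) ` carrier_vec n = carrier_vec m"
  shows "vec_space.rank m A = m"
proof -
  interpret V: vec_space "TYPE('a)" m .
  have "V.span (set (cols A)) = (\<lambda>x. A *\<^sub>v x) ` carrier_vec n"
    using V.col_space_eq[OF A] A unfolding V.col_space_def by (auto simp: image_iff)
  then have "V.span (set (cols A)) = carrier_vec m"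
    by (simp only: surj)
  then have "V.vs (V.span (set (cols A))) = V.V"
    by (simp add: module_vec_def)
  then show ?thesis
    unfolding V.rank_def using V.dim_is_n by simp
qed

section \<open>Coefficient vectors, generator matrices and dimension\<close>

definition vec_poly :: "'a::comm_monoid_add vec \<Rightarrow> 'a poly" where
  "vec_poly a = (\<Sum>i<dim_vec a. monom (a $ i) i)"

lemma coeff_vec_poly: "coeff (vec_poly a) i = (if i < dim_vec a then a $ i else 0)"
  by (simp add: vec_poly_def coeff_sum)

lemma degree_vec_poly:
  assumes "0 < dim_vec a"
  shows "degree (vec_poly a) < dim_vec a"
  using degree_le[of "dim_vec a - 1" "vec_poly a"] assms by (force simp: coeff_vec_poly)

lemma vec_poly_image:
  assumes "0 < k"
  shows "vec_poly ` carrier_vec k = {p. degree p < k}"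
proof
  show "{p. degree p < k} \<subseteq> (vec_poly ` carrier_vec k :: 'a poly set)"
  proof
    fix p :: "'a poly" assume "p \<in> {p. degree p < k}"
    then have "p = vec_poly (vec k (coeff p))"
      by (auto intro!: poly_eqI simp: coeff_vec_poly coeff_eq_0)
    then show "p \<in> vec_poly ` carrier_vec k"
      by (metis imageI vec_carrier)
  qed
next
  have "degree (vec_poly a) < k" if "a \<in> carrier_vec k" for a :: "'a vec"
    using degree_vec_poly[of a] that assms by simp
  then show "vec_poly ` carrier_vec k \<subseteq> {p :: 'a poly. degree p < k}"
    by blast
qed

lemma inj_on_vec_poly: "inj_on vec_poly (carrier_vec k)"
proof (rule inj_onI)
  fix a b :: "'a vec" assume "a \<in> carrier_vec k" "b \<in> carrier_vec k" "vec_poly a = vec_poly b"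
  then have "coeff (vec_poly a) i = coeff (vec_poly b) i" "dim_vec a = k" "dim_vec b = k" for i
    by auto
  then show "a = b"
    by (intro eq_vecI) (simp_all add: coeff_vec_poly split: if_splits, metis)
qed

context primitive_root
begin

text \<open>A transposed generator matrix: the basis codewords are its columns, so that encoding is
  multiplication by a column vector and the code is the column space.\<close>

definition gen_mat :: "nat \<Rightarrow> nat \<Rightarrow> 'a mat" where
  "gen_mat s k = mat n k (\<lambda>(j, i). \<omega> ^ ((s + i) * j))"

lemma gen_mat_carrier [simp]: "gen_mat s k \<in> carrier_mat n k"
  by (simp add: gen_mat_def)

lemma cols_gen_mat: "cols (gen_mat s k) = map (\<lambda>i. eval_vec s (monom 1 i)) [0..<k]"
  by (rule nth_equalityI)
    (auto simp: gen_mat_def poly_monom algebra_simps power_add intro!: eq_vecI simp flip: power_mult)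

lemma gen_mat_mult_vec:
  assumes "a \<in> carrier_vec k"
  shows "gen_mat s k *\<^sub>v a = eval_vec s (vec_poly a)"
proof (rule eq_vecI)
  fix j assume j: "j < dim_vec (eval_vec s (vec_poly a))"
  then have "(gen_mat s k *\<^sub>v a) $ j = (\<Sum>i<k. \<omega> ^ ((s + i) * j) * a $ i)"
    using assms by (simp add: gen_mat_def scalar_prod_def atLeast0LessThan)
  also have "\<dots> = eval_vec s (vec_poly a) $ j"
    using j assms by (simp add: vec_poly_def poly_sum poly_monom sum_distrib_left algebra_simps
        power_add flip: power_mult)
  finally show "(gen_mat s k *\<^sub>v a) $ j = eval_vec s (vec_poly a) $ j" .
qed (simp add: gen_mat_def)

lemma rs_code_eq_image:
  assumes "0 < k"
  shows "rs_code s k = (\<lambda>a. gen_mat s k *\<^sub>v a) ` carrier_vec k"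
proof -
  have "rs_code s k = eval_vec s ` vec_poly ` carrier_vec k"
    using assms by (simp add: rs_code_def vec_poly_image)
  then show ?thesis
    by (simp add: image_image gen_mat_mult_vec)
qed

lemma inj_on_gen_mat:
  assumes "0 < k" "k \<le> n"
  shows "inj_on (\<lambda>a. gen_mat s k *\<^sub>v a) (carrier_vec k)"
proof -
  have "inj_on (eval_vec s \<circ> vec_poly) (carrier_vec k)"
    using assms by (intro comp_inj_on inj_on_vec_poly inj_on_subset[OF inj_on_eval_vec])
      (auto simp: vec_poly_image)
  then show ?thesis
    by (simp add: inj_on_def gen_mat_mult_vec)
qed

lemma span_eval_vec_monom:
  assumes "0 < k"
  shows "module.span class_ring (module_vec TYPE('a) n) ((\<lambda>i. eval_vec s (monom 1 i)) ` {..<k})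
    = rs_code s k"
proof -
  interpret V: vec_space "TYPE('a)" n .
  have "set (cols (gen_mat s k)) = (\<lambda>i. eval_vec s (monom 1 i)) ` {..<k}"
    by (simp add: cols_gen_mat atLeast0LessThan)
  moreover have "V.span (set (cols (gen_mat s k))) = rs_code s k"
    using V.col_space_eq[OF gen_mat_carrier, of s k] gen_mat_carrier[of s k]
    unfolding V.col_space_def rs_code_eq_image[OF assms]
    by (auto simp: image_iff gen_mat_mult_vec)
  ultimately show ?thesis
    by simp
qed

text \<open>Injectivity of the encoding makes the columns of the generator matrix independent, and
  the rank is by definition the dimension of their span.\<close>

lemma dim_rs_code:
  assumes "0 < k" "k \<le> n"
  shows "vectorspace.dim class_ring ((module_vec TYPE('a) n)\<lparr>carrier := rs_code s k\<rparr>) = k"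
proof -
  interpret V: vec_space "TYPE('a)" n .
  let ?A = "gen_mat s k"
  \<comment> \<open>Independence concerns the set of columns, so repeated columns have to be
    excluded first.\<close>
  have "inj_on (\<lambda>i. eval_vec s (monom 1 i)) {0..<k}"
  proof (rule inj_onI)
    fix i j assume ij: "i \<in> {0..<k}" "j \<in> {0..<k}"
      and eq: "eval_vec s (monom 1 i) = eval_vec s (monom 1 j)"
    have "monom (1::'a) i = monom 1 j"
      using inj_onD[OF inj_on_eval_vec eq] ij assms by (simp add: degree_monom_eq)
    then have "degree (monom (1::'a) i) = degree (monom (1::'a) j)"
      by simp
    then show "i = j"
      by (simp add: degree_monom_eq)
  qed
  then have distinct: "distinct (cols ?A)"
    by (simp add: cols_gen_mat distinct_map)
  have "V.lin_indpt (set (cols ?A))"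
  proof
    assume "V.lin_dep (set (cols ?A))"
    then obtain v where v: "v \<in> carrier_vec k" "v \<noteq> 0\<^sub>v k" "?A *\<^sub>v v = 0\<^sub>v n"
      using V.lin_depE[OF gen_mat_carrier _ distinct] by blast
    moreover have "?A *\<^sub>v 0\<^sub>v k = 0\<^sub>v n"
      by (intro eq_vecI) (auto simp: gen_mat_def)
    ultimately show False
      using inj_onD[OF inj_on_gen_mat[OF assms], of s v "0\<^sub>v k"] by simp
  qed
  then have "V.rank ?A = k"
    by (rule V.lin_indpt_full_rank[OF gen_mat_carrier distinct])
  moreover have "V.span (set (cols ?A)) = rs_code s k"
    using span_eval_vec_monom[OF assms(1), of s] by (simp add: cols_gen_mat atLeast0LessThan)
  ultimately show ?thesis
    by (simp add: V.rank_def)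
qed

lemma rs_code_subspace:
  assumes "0 < k"
  shows "VectorSpace.subspace class_ring (rs_code s k) (module_vec TYPE('a) n)"
proof -
  interpret V: vec_space "TYPE('a)" n .
  show ?thesis
    unfolding span_eval_vec_monom[OF assms, of s, symmetric]
    by (rule V.span_is_subspace) auto
qed

section \<open>Minimum distance\<close>

lemma hamming_dist_eval_vec:
  "hamming_dist (eval_vec s p) (eval_vec s p') + card {j. j < n \<and> eval_vec s (p - p') $ j = 0} = n"
proof -
  let ?N = "{j. j < n \<and> eval_vec s (p - p') $ j \<noteq> 0}"
  have "{j. j < n \<and> eval_vec s p $ j \<noteq> eval_vec s p' $ j} = ?N"
    by (auto simp: eval_vec_diff)
  moreover have "?N \<union> {j. j < n \<and> eval_vec s (p - p') $ j = 0} = {..<n}"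
    by auto
  then have "card ?N + card {j. j < n \<and> eval_vec s (p - p') $ j = 0} = card {..<n}"
    by (subst card_Un_disjoint[symmetric]) auto
  ultimately show ?thesis
    by (simp add: hamming_dist_def)
qed

text \<open>The difference of the two polynomials is nonzero of degree below k, so the words agree
  in fewer than k positions.\<close>

lemma rs_code_distance_ge:
  assumes "k \<le> n" "x \<in> rs_code s k" "y \<in> rs_code s k" "x \<noteq> y"
  shows "n - k + 1 \<le> hamming_dist x y"
proof -
  obtain p p' where p: "degree p < k" "degree p' < k" "x = eval_vec s p" "y = eval_vec s p'"
    using assms by (auto simp: rs_code_def)
  then have "p - p' \<noteq> 0"
    using assms(4) by auto
  then have "card {j. j < n \<and> eval_vec s (p - p') $ j = 0} < k"
    using eval_vec_zeros[of "p - p'" s] degree_diff_less[OF p(1,2)] by simp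
  then show ?thesis
    using hamming_dist_eval_vec[of s p p'] p assms(1) by simp
qed

lemma rs_code_min_distance:
  assumes k: "0 < k" "k \<le> n"
  shows "is_min_distance (n - k + 1) (rs_code s k)"
proof -
  \<comment> \<open>A polynomial with k - 1 roots among the evaluation points, the most that degree
    below k allows, attains the bound; for k = 1 it is the constant 1.\<close>
  let ?S = "(\<lambda>j. \<omega> ^ j) ` {..<k - 1}"
  let ?p = "\<Prod>a\<in>?S. [:-a, 1:]"
  have inj: "inj_on (\<lambda>j. \<omega> ^ j) {..<k - 1}"
    by (rule inj_on_subset[OF inj_on_root_power]) (use k in auto)
  have deg: "degree ?p = k - 1"
    using inj by (simp add: degree_prod_roots card_image)
  have "?p \<noteq> 0"
    by simp
  have zero: "eval_vec s ?p $ j = 0" if "j < k - 1" for j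
  proof -
    have "poly ?p (\<omega> ^ j) = 0"
      using that by (subst poly_prod_roots_eq_0_iff) auto
    then show ?thesis
      using that k by simp
  qed
  have "{..<k - 1} \<subseteq> {j. j < n \<and> eval_vec s ?p $ j = 0}"
    using k zero by auto
  then have "card {..<k - 1} \<le> card {j. j < n \<and> eval_vec s ?p $ j = 0}"
    by (intro card_mono) auto
  then have card: "card {j. j < n \<and> eval_vec s ?p $ j = 0} = k - 1"
    using eval_vec_zeros[OF \<open>?p \<noteq> 0\<close>, of s] deg by simp
  have ne: "eval_vec s ?p \<noteq> eval_vec s 0"
    using inj_onD[OF inj_on_eval_vec, of s ?p 0] deg k \<open>?p \<noteq> 0\<close> by fastforce
  have "hamming_dist (eval_vec s ?p) (eval_vec s 0) = n - k + 1"
    using hamming_dist_eval_vec[of s ?p 0] card k by simp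
  moreover have "eval_vec s ?p \<in> rs_code s k" "eval_vec s 0 \<in> rs_code s k"
    using deg k by (auto simp: rs_code_def)
  ultimately show ?thesis
    unfolding is_min_distance_def using ne rs_code_distance_ge[OF k(2)] by blast
qed

lemma linear_code_rs_code:
  assumes "0 < k" "k \<le> n"
  shows "linear_code n k (n - k + 1) (rs_code s k)"
  unfolding linear_code_def
  using assms rs_code_subspace dim_rs_code rs_code_min_distance by blast

end

section \<open>Check matrices over a finite field\<close>

locale primitive_root_finite = primitive_root n \<omega>
  for n :: nat and \<omega> :: "'a::{field, finite}"
begin

lemma card_rs_code:
  assumes "0 < k" "k \<le> n"
  shows "card (rs_code s k) = CARD('a) ^ k"
  using assms by (simp add: rs_code_eq_image card_image inj_on_gen_mat card_carrier_vec)

lemma check_matrix_mult_surj: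
  assumes k: "0 < k" "k < n" and H: "H \<in> carrier_mat (n - k) n" "mat_kernel H = rs_code s k"
  shows "(\<lambda>x. H *\<^sub>v x) ` carrier_vec n = carrier_vec (n - k)"
  by (rule mult_mat_vec_surj_of_card_kernel[OF H(1)]) (use k H(2) card_rs_code[of k s] in auto)

text \<open>The rows are the basis words of the dual code; full rank follows from the size of the
  kernel.\<close>

lemma exists_check_matrix:
  assumes k: "0 < k" "k < n" and s: "n dvd s' + s + (n - 1)"
  shows "\<exists>H. check_matrix n k H (rs_code s k)"
proof -
  let ?H = "(gen_mat s' (n - k))\<^sup>T"
  have H: "?H \<in> carrier_mat (n - k) n"
    by simp
  have "row ?H i = eval_vec s' (monom 1 i)" if "i < n - k" for i
  proof -
    have "row ?H i = col (gen_mat s' (n - k)) i"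
      using that carrier_matD[OF gen_mat_carrier[of s' "n - k"]] by simp
    also have "\<dots> = cols (gen_mat s' (n - k)) ! i"
      using that carrier_matD[OF gen_mat_carrier[of s' "n - k"]] by (simp only: cols_nth)
    finally show ?thesis
      using that by (simp add: cols_gen_mat)
  qed
  then have "(?H *\<^sub>v x) $ i = eval_vec s' (monom 1 i) \<bullet> x" if "i < n - k" for i x
    using that carrier_matD[OF H] by (simp del: row_transpose)
  then have "?H *\<^sub>v x = 0\<^sub>v (n - k) \<longleftrightarrow> (\<forall>i<n - k. eval_vec s' (monom 1 i) \<bullet> x = 0)" for x
    using carrier_matD[OF H] unfolding vec_eq_iff by (simp del: row_transpose)
  then have "mat_kernel ?H = rs_code s k"
    unfolding rs_code_dual[OF k s] mat_kernel[OF H] by simp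
  moreover from this have "vec_space.rank (n - k) ?H = n - k"
    by (intro rank_eq_of_surj[OF H] check_matrix_mult_surj[OF k H])
  ultimately show ?thesis
    using H unfolding check_matrix_def by blast
qed

end

section \<open>Additive characters\<close>

(* The character is trivial on an additive subgroup V that is maximal among those without 1, and
   sends 1 to exp (2 \<pi> i / p); maximality gives that V and 1 generate the field. *)
lemma exists_nontrivial_additive_character:
  "\<exists>\<chi> :: 'a::{field, finite} \<Rightarrow> complex. additive_character \<chi> \<and> \<chi> 1 \<noteq> 1"
proof -
  define p where "p = CHAR('a)"
  have p: "prime p"
    unfolding p_def by (rule prime_CHAR_semidom) (simp add: finite_imp_CHAR_pos)
  have of_nat_p: "of_nat p = (0::'a)"
    by (simp add: p_def)
  \<comment> \<open>Only natural multiples are used as scalars, so inverses in the prime field are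
    needed as natural numbers too.\<close>
  have inv_mod_p: "\<exists>i. of_nat i * of_nat j = (1::'a)" if "\<not> p dvd j" for j
  proof -
    have "coprime j p"
      using p that by (metis coprime_commute prime_imp_coprime)
    then obtain i where "cong (j * i) 1 p"
      using cong_solve_coprime_nat by auto
    then have "(of_nat (j * i) :: 'a) = of_nat 1"
      unfolding of_nat_eq_iff_cong_CHAR p_def .
    then show ?thesis
      by (metis mult.commute of_nat_1 of_nat_mult)
  qed
  \<comment> \<open>Closure under addition suffices for a subgroup: negation is multiplication by p
    - 1.\<close>
  define F where "F = {V :: 'a set. 0 \<in> V \<and> (\<forall>x\<in>V. \<forall>y\<in>V. x + y \<in> V) \<and> 1 \<notin> V}"
  have "{0} \<in> F"
    by (simp add: F_def)
  then obtain V where V: "V \<in> F" "\<And>W. W \<in> F \<Longrightarrow> V \<subseteq> W \<Longrightarrow> V = W"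
    using finite_has_maximal[of F] by auto
  have V0: "0 \<in> V" and V_add: "\<And>x y. x \<in> V \<Longrightarrow> y \<in> V \<Longrightarrow> x + y \<in> V" and V1: "1 \<notin> V"
    using V(1) by (auto simp: F_def)
  have V_mult: "of_nat j * x \<in> V" if "x \<in> V" for j x
    by (induction j) (use that V0 V_add in \<open>auto simp: algebra_simps\<close>)
  have V_uminus: "- x \<in> V" if "x \<in> V" for x
  proof -
    have "of_nat (p - 1) = (- 1 :: 'a)"
      using of_nat_p prime_gt_0_nat[OF p] by (simp add: of_nat_diff)
    then show ?thesis
      using V_mult[OF that, of "p - 1"] by simp
  qed
  have V_of_nat: "p dvd j" if "of_nat j \<in> V" for j
    using inv_mod_p[of j] V_mult[OF that] V1 by metis
  have cover: "\<exists>m. x - of_nat m \<in> V" for x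
  proof (cases "x \<in> V")
    case True
    then show ?thesis
      by (intro exI[of _ 0]) simp
  next
    case False
    \<comment> \<open>The subgroup generated by \<open>V\<close> and x properly contains
      \<open>V\<close>, so by maximality it contains 1; solving 1 = v + j x for x then gives x
      modulo \<open>V\<close>.\<close>
    define W where "W = {v + of_nat j * x |v j. v \<in> V}"
    have W_add: "a + b \<in> W" if ab: "a \<in> W" "b \<in> W" for a b
    proof -
      obtain v j w k where "a = v + of_nat j * x" "v \<in> V" "b = w + of_nat k * x" "w \<in> V"
        using ab by (auto simp: W_def)
      then have "a + b = (v + w) + of_nat (j + k) * x" "v + w \<in> V"
        using V_add by (simp_all add: algebra_simps)
      then show ?thesis
        unfolding W_def by blast
    qed
    have VW: "V \<subseteq> W"
    proof
      fix v assume "v \<in> V"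
      then show "v \<in> W"
        unfolding W_def by (intro CollectI exI[of _ v] exI[of _ 0]) simp
    qed
    have "x \<in> W"
      unfolding W_def using V0 by (intro CollectI exI[of _ 0] exI[of _ 1]) simp
    then have "W \<notin> F"
      using V(2)[OF _ VW] False by blast
    then have "1 \<in> W"
      using W_add VW V0 by (auto simp: F_def)
    then obtain v j where j: "v \<in> V" "1 = v + of_nat j * x"
      by (auto simp: W_def)
    have "\<not> p dvd j"
    proof
      assume "p dvd j"
      then have "(of_nat j :: 'a) = 0"
        using of_nat_p by (auto elim: dvdE)
      then show False
        using j V1 by simp
    qed
    then obtain i where i: "of_nat i * of_nat j = (1::'a)"
      using inv_mod_p by blast
    have "of_nat j * x = 1 - v"
      using j by (simp add: algebra_simps)
    then have "x = of_nat i * (1 - v)"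
      using i by (metis mult.assoc mult_1)
    then have "x - of_nat i = - (of_nat i * v)"
      by (simp add: algebra_simps)
    then show ?thesis
      using V_uminus[OF V_mult[OF j(1)]] by metis
  qed
  define \<zeta> where "\<zeta> = cis (2 * pi / p)"
  have \<zeta>_p: "\<zeta> ^ p = 1"
    using prime_gt_0_nat[OF p] by (simp add: \<zeta>_def DeMoivre)
  have uniq: "\<zeta> ^ m = \<zeta> ^ m'" if m: "x - of_nat m \<in> V" "x - of_nat m' \<in> V" for x m m'
  proof -
    \<comment> \<open>Adding (p - 1) m' stands for subtracting m', which keeps the exponents of
      \<zeta> natural.\<close>
    have p1: "m' + (p - 1) * m' = p * m'"
      using prime_gt_0_nat[OF p] by (cases p) auto
    have "(of_nat (m + (p - 1) * m') :: 'a) = of_nat m - of_nat m'"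
      using arg_cong[OF p1, of "of_nat :: nat \<Rightarrow> 'a"] of_nat_p by (simp add: algebra_simps eq_neg_iff_add_eq_0)
    also have "\<dots> = (x - of_nat m') + - (x - of_nat m)"
      by simp
    also have "\<dots> \<in> V"
      using m V_add V_uminus by blast
    finally have "p dvd m + (p - 1) * m'"
      by (rule V_of_nat)
    then have "\<zeta> ^ m * \<zeta> ^ ((p - 1) * m') = 1"
      using \<zeta>_p unfolding power_add[symmetric] by (auto elim!: dvdE simp: power_mult)
    moreover have "\<zeta> ^ m' * \<zeta> ^ ((p - 1) * m') = 1"
      unfolding power_add[symmetric] p1 by (simp add: power_mult \<zeta>_p)
    ultimately show ?thesis
      by (metis mult_cancel_right mult_zero_right zero_neq_one)
  qed
  define \<chi> where "\<chi> x = \<zeta> ^ (SOME m. x - of_nat m \<in> V)" for x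
  have \<chi>: "\<chi> x = \<zeta> ^ m" if "x - of_nat m \<in> V" for x m
    unfolding \<chi>_def by (rule uniq[OF _ that]) (rule someI_ex[OF cover])
  have "\<chi> (x + y) = \<chi> x * \<chi> y" for x y
  proof -
    obtain m k where mk: "x - of_nat m \<in> V" "y - of_nat k \<in> V"
      using cover by blast
    have "(x + y) - of_nat (m + k) = (x - of_nat m) + (y - of_nat k)"
      by simp
    then have "(x + y) - of_nat (m + k) \<in> V"
      using V_add[OF mk] by metis
    from \<chi>[OF this] show ?thesis
      by (simp add: \<chi>[OF mk(1)] \<chi>[OF mk(2)] power_add)
  qed
  moreover have "\<chi> 0 = 1"
    using \<chi>[of 0 0] V0 by simp
  moreover have "\<chi> 1 \<noteq> 1"
  proof -
    \<comment> \<open>Comparing k = 1 with k = 0 gives \<zeta> \<noteq> 1, and \<chi> 1 = \<zeta>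
      because 1 - 1 = 0 lies in \<open>V\<close>.\<close>
    have "inj_on (\<lambda>k. cis (2 * pi * real k / real p)) {..<p}"
      using bij_betw_roots_unity[OF prime_gt_0_nat[OF p]] by (rule bij_betw_imp_inj_on)
    then have "\<zeta> \<noteq> 1"
      using inj_onD[of _ "{..<p}" 1 0] prime_gt_1_nat[OF p] by (fastforce simp: \<zeta>_def)
    then show ?thesis
      using \<chi>[of 1 1] V0 by simp
  qed
  ultimately show ?thesis
    unfolding additive_character_def by blast
qed

text \<open>Rescaling the argument by 1 / z moves z to 1, where a nontrivial value is known.\<close>

lemma additive_character_separates:
  fixes z :: "'a::{field, finite}"
  assumes "z \<noteq> 0"
  shows "\<exists>\<chi> :: 'a \<Rightarrow> complex. additive_character \<chi> \<and> \<chi> z \<noteq> 1"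
proof -
  obtain \<chi> :: "'a \<Rightarrow> complex" where \<chi>: "additive_character \<chi>" "\<chi> 1 \<noteq> 1"
    using exists_nontrivial_additive_character by blast
  have "additive_character (\<lambda>x. \<chi> (x / z))"
    using \<chi>(1) by (simp add: additive_character_def add_divide_distrib)
  then show ?thesis
    using \<chi>(2) assms by (intro exI[of _ "\<lambda>x. \<chi> (x / z)"]) simp
qed

section \<open>The code space and its distance\<close>

text \<open>The interface through which the two codes enter the quantum part:
  \<open>nondegenerate\<close> makes the encoder isometric, \<open>g\<close> supplies the messages,
  \<open>kernel_weight\<close> kills the off-diagonal entries of an error and
  \<open>prescribe\<close> makes its diagonal constant.\<close>

locale ea_css =
  fixes n k c d :: nat and H K :: "'a::{field, finite} mat" and g :: "'a vec \<Rightarrow> 'a vec"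
  assumes H: "H \<in> carrier_mat c n" and K: "K \<in> carrier_mat c n"
    and nondegenerate: "u \<in> carrier_vec c \<Longrightarrow> K *\<^sub>v (H\<^sup>T *\<^sub>v u) = 0\<^sub>v c \<Longrightarrow> u = 0\<^sub>v c"
    and g: "bij_betw g (carrier_vec k) (mat_kernel K)"
    and kernel_weight: "z \<in> mat_kernel K \<Longrightarrow> z \<noteq> 0\<^sub>v n \<Longrightarrow> d \<le> card {i. i < n \<and> z $ i \<noteq> 0}"
    and prescribe: "S \<subseteq> {..<n} \<Longrightarrow> card S < d
      \<Longrightarrow> \<exists>u\<in>carrier_vec c. \<forall>j\<in>S. (H\<^sup>T *\<^sub>v u) $ j = z $ j"
begin

section \<open>Orbit coordinates and the orthogonal projector\<close>

abbreviation W :: "'a vec \<Rightarrow> 'a vec" where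
  "W u \<equiv> H\<^sup>T *\<^sub>v u"

abbreviation D :: "'a vec set" where
  "D \<equiv> mat_kernel K"

lemma dims [simp]: "dim_row H = c" "dim_col H = n" "dim_row K = c" "dim_col K = n"
  using H K by auto

lemma W_carrier [simp]: "W u \<in> carrier_vec n"
  by (intro carrier_vecI) simp

lemma W_minus: "t \<in> carrier_vec c \<Longrightarrow> u \<in> carrier_vec c \<Longrightarrow> W (t - u) = W t - W u"
  using H by (intro mult_minus_distrib_mat_vec[of _ n c]) auto

lemma W_add: "t \<in> carrier_vec c \<Longrightarrow> u \<in> carrier_vec c \<Longrightarrow> W (t + u) = W t + W u"
  using H by (intro mult_add_distrib_mat_vec[of _ n c]) auto

lemma D_carrier: "z \<in> D \<Longrightarrow> z \<in> carrier_vec n"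
  using mat_kernelD[OF K] by blast

lemma D_iff: "z \<in> carrier_vec n \<Longrightarrow> z \<in> D \<longleftrightarrow> K *\<^sub>v z = 0\<^sub>v c"
  using mat_kernel[OF K] by auto

lemma minus_W_eq_iff:
  "x \<in> carrier_vec n \<Longrightarrow> z \<in> carrier_vec n \<Longrightarrow> x - W t = z \<longleftrightarrow> x = z + W t"
  by (auto simp: vec_eq_iff algebra_simps)

text \<open>Coordinates on the code space: the X-type stabilizers make a state a function of x - W
  t, the Z-type ones confine that word to \<open>D\<close>, and f gives the amplitude on each orbit,
  without normalisation.\<close>

definition emb :: "('a vec \<Rightarrow> complex) \<Rightarrow> 'a vec \<times> 'a vec \<Rightarrow> complex" where
  "emb f = (\<lambda>(x, t). if (x, t) \<in> ea_basis n c \<and> x - W t \<in> D then f (x - W t) else 0)"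

text \<open>The mean over the orbit of (z, 0) under the X-type stabilizers; a left inverse of
  \<open>emb\<close> on \<open>D\<close>.\<close>

definition avg :: "('a vec \<times> 'a vec \<Rightarrow> complex) \<Rightarrow> 'a vec \<Rightarrow> complex" where
  "avg v z = (\<Sum>u\<in>carrier_vec c. v (z + W u, u)) / of_nat (CARD('a) ^ c)"

lemma emb_cong: "(\<And>z. z \<in> D \<Longrightarrow> f z = f' z) \<Longrightarrow> emb f = emb f'"
  by (auto simp: emb_def fun_eq_iff)

lemma emb_shift: "z \<in> D \<Longrightarrow> u \<in> carrier_vec c \<Longrightarrow> emb f (z + W u, u) = f z"
  using D_carrier[of z] minus_W_eq_iff[of "z + W u" z u] by (simp add: emb_def)

lemma avg_emb: "z \<in> D \<Longrightarrow> avg (emb f) z = f z"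
  by (simp add: avg_def emb_shift card_carrier_vec)

text \<open>Matrix of the averaging over orbits, which have q^c points each, restricted to the
  orbits that belong to \<open>D\<close>.\<close>

definition proj :: "'a vec \<times> 'a vec \<Rightarrow> 'a vec \<times> 'a vec \<Rightarrow> complex" where
  "proj = (\<lambda>(x, t) (y, u). if x - W t = y - W u \<and> x - W t \<in> D
     then 1 / of_nat (CARD('a) ^ c) else 0)"

text \<open>For each receiver label u the orbit of (x, t) contains just one y, namely (x - W t) + W
  u, so the double sum collapses to a mean over u.\<close>

lemma apply_proj: "apply_op (ea_basis n c) proj v = emb (avg v)"
proof (rule ext, clarify)
  fix x t
  show "apply_op (ea_basis n c) proj v (x, t) = emb (avg v) (x, t)"
  proof (cases "(x, t) \<in> ea_basis n c \<and> x - W t \<in> D")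
    case True
    let ?z = "x - W t"
    have z: "?z \<in> carrier_vec n"
      using True D_carrier by blast
    have "apply_op (ea_basis n c) proj v (x, t)
        = (\<Sum>(y, u)\<in>ea_basis n c. if y = ?z + W u then v (y, u) / of_nat (CARD('a) ^ c) else 0)"
      unfolding apply_op_def using True
      by (auto intro!: sum.cong simp: proj_def minus_W_eq_iff[OF _ z] eq_commute[of ?z])
    also have "\<dots> = (\<Sum>y\<in>carrier_vec n. \<Sum>u\<in>carrier_vec c.
        if y = ?z + W u then v (y, u) / of_nat (CARD('a) ^ c) else 0)"
      by (rule sum.cartesian_product[symmetric])
    also have "\<dots> = (\<Sum>u\<in>carrier_vec c. \<Sum>y\<in>carrier_vec n.
        if y = ?z + W u then v (y, u) / of_nat (CARD('a) ^ c) else 0)"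
      by (rule sum.swap)
    also have "\<dots> = (\<Sum>u\<in>carrier_vec c. v (?z + W u, u) / of_nat (CARD('a) ^ c))"
      using z by (simp add: sum.delta)
    finally show ?thesis
      using True by (simp add: emb_def avg_def sum_divide_distrib)
  qed (auto simp: apply_op_def emb_def proj_def)
qed

lemma orthogonal_projector: "is_orthogonal_projector (ea_basis n c) (range emb) proj"
proof -
  have "apply_op (ea_basis n c) proj v = v" if "v \<in> range emb" for v
    using that by (auto simp: apply_proj intro!: emb_cong avg_emb)
  then show ?thesis
    unfolding is_orthogonal_projector_def by (auto simp: apply_proj) (auto simp: proj_def)
qed

section \<open>Errors on fewer than d channel qudits\<close>

lemma has_distance: "has_distance n c d (range emb)"
  unfolding has_distance_def
proof (intro exI[of _ proj] conjI orthogonal_projector allI impI)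
  fix S :: "nat set" and E :: "'a vec \<Rightarrow> 'a vec \<Rightarrow> complex"
  assume "S \<subseteq> {..<n} \<and> card S < d \<and> acts_only_on n S E"
  then obtain G where S: "S \<subseteq> {..<n}" "card S < d"
    and E: "\<And>x y. x \<in> carrier_vec n \<Longrightarrow> y \<in> carrier_vec n \<Longrightarrow>
      E x y = (if \<forall>i<n. i \<notin> S \<longrightarrow> x $ i = y $ i
        then G (restrict (($) x) S) (restrict (($) y) S) else 0)"
    unfolding acts_only_on_def by blast
  have fin: "finite S"
    using S(1) finite_subset by blast
  \<comment> \<open>The mean of the diagonal entries on the orbit of the zero word;
    \<open>shift\<close> shows that the orbits of all words of \<open>D\<close> share it.\<close>
  define \<mu> where "\<mu> = (\<Sum>u\<in>carrier_vec c. E (W u) (W u)) / of_nat (CARD('a) ^ c)"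
  have diag: "E x x = E y y" if "x \<in> carrier_vec n" "y \<in> carrier_vec n" "\<forall>j\<in>S. x $ j = y $ j" for x y
  proof -
    have "restrict (($) x) S = restrict (($) y) S"
      using that(3) by (auto simp: restrict_def)
    then show ?thesis
      using that by (simp add: E)
  qed
  have shift: "(\<Sum>u\<in>carrier_vec c. E (z + W u) (z + W u)) = (\<Sum>u\<in>carrier_vec c. E (W u) (W u))"
    if "z \<in> D" for z
  proof -
    have z: "z \<in> carrier_vec n"
      by (rule D_carrier[OF that])
    \<comment> \<open>Since W w agrees with z on \<open>S\<close>, the words z + W u and W (w + u)
      have the same diagonal entry, and u can be replaced by u - w.\<close>
    obtain w where w: "w \<in> carrier_vec c" "\<forall>j\<in>S. W w $ j = z $ j"
      using prescribe[OF S] by blast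
    have "(\<Sum>u\<in>carrier_vec c. E (z + W u) (z + W u))
        = (\<Sum>u\<in>carrier_vec c. E (W (w + u)) (W (w + u)))"
    proof (rule sum.cong[OF refl])
      fix u :: "'a vec" assume "u \<in> carrier_vec c"
      then show "E (z + W u) (z + W u) = E (W (w + u)) (W (w + u))"
        using z w S(1) by (intro diag) (auto simp: W_add subset_iff)
    qed
    also have "\<dots> = (\<Sum>u\<in>carrier_vec c. E (W u) (W u))"
      by (rule sum.reindex_bij_witness[of _ "\<lambda>u. u - w" "\<lambda>u. w + u"])
        (use w in \<open>auto intro!: eq_vecI\<close>)
    finally show ?thesis .
  qed
  \<comment> \<open>The identity on the receiver's side fixes u, so only entries between words with
    the same label u occur.\<close>
  have off_diag: "E (z + W u) y * emb f (y, u) = (if y = z + W u then E y y * f z else 0)"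
    if "z \<in> D" "u \<in> carrier_vec c" "y \<in> carrier_vec n" for z u y f
  proof (cases "E (z + W u) y * emb f (y, u) = 0")
    case True
    then show ?thesis
      using emb_shift[OF that(1,2)] by auto
  next
    case False
    have z: "z \<in> carrier_vec n"
      by (rule D_carrier[OF that(1)])
    have y: "y - W u \<in> D" and agree: "\<forall>i<n. i \<notin> S \<longrightarrow> (z + W u) $ i = y $ i"
      using False that z by (auto simp: emb_def E split: if_splits)
    \<comment> \<open>A nonzero entry forces y and z + W u to agree outside \<open>S\<close>; hence
      this difference of two words of \<open>D\<close> has weight below d and must vanish.\<close>
    let ?e = "(y - W u) - z"
    have e: "?e \<in> carrier_vec n"
      using that z by simp
    have "?e \<in> D"
      using y that(1) z that(3) unfolding D_iff[OF e]
      by (subst mult_minus_distrib_mat_vec[OF K]) (auto simp: D_iff D_carrier)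
    moreover have "{i. i < n \<and> ?e $ i \<noteq> 0} \<subseteq> S"
    proof clarify
      fix i assume i: "i < n" "?e $ i \<noteq> 0"
      show "i \<in> S"
      proof (rule ccontr)
        assume "i \<notin> S"
        then have "z $ i + W u $ i = y $ i"
          using agree i z by simp
        then show False
          using i z that(3) by (simp add: algebra_simps)
      qed
    qed
    then have "card {i. i < n \<and> ?e $ i \<noteq> 0} < d"
      using card_mono[OF fin] S(2) le_less_trans by blast
    ultimately have "?e = 0\<^sub>v n"
      using kernel_weight not_le by blast
    then have "y = z + W u"
      using that(3) z by (auto simp: vec_eq_iff algebra_simps)
    then show ?thesis
      using emb_shift[OF that(1,2)] by simp
  qed
  \<comment> \<open>In orbit coordinates the compressed error is multiplication by \<mu>.\<close>
  have key: "avg (apply_op (ea_basis n c) (tensor_id E) (emb f)) z = \<mu> * f z" if "z \<in> D" for f z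
  proof -
    have z: "z \<in> carrier_vec n"
      by (rule D_carrier[OF that])
    have "apply_op (ea_basis n c) (tensor_id E) (emb f) (z + W u, u) = E (z + W u) (z + W u) * f z"
      if u: "u \<in> carrier_vec c" for u
    proof -
      have "apply_op (ea_basis n c) (tensor_id E) (emb f) (z + W u, u)
          = (\<Sum>(y, s)\<in>ea_basis n c. if s = u then E (z + W u) y * emb f (y, u) else 0)"
        unfolding apply_op_def using u z by (auto intro!: sum.cong simp: tensor_id_def)
      also have "\<dots> = (\<Sum>y\<in>carrier_vec n. \<Sum>s\<in>carrier_vec c.
          if s = u then E (z + W u) y * emb f (y, u) else 0)"
        by (rule sum.cartesian_product[symmetric])
      also have "\<dots> = (\<Sum>y\<in>carrier_vec n. E (z + W u) y * emb f (y, u))"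
        using u by (simp add: sum.delta)
      also have "\<dots> = (\<Sum>y\<in>carrier_vec n. if y = z + W u then E y y * f z else 0)"
        by (rule sum.cong) (use off_diag[OF \<open>z \<in> D\<close> u] in auto)
      also have "\<dots> = E (z + W u) (z + W u) * f z"
        using z by (simp add: sum.delta)
      finally show ?thesis .
    qed
    then have "avg (apply_op (ea_basis n c) (tensor_id E) (emb f)) z
        = (\<Sum>u\<in>carrier_vec c. E (z + W u) (z + W u) * f z) / of_nat (CARD('a) ^ c)"
      by (simp add: avg_def)
    then show ?thesis
      by (simp add: \<mu>_def shift[OF that] flip: sum_distrib_right)
  qed
  have "emb (avg (apply_op (ea_basis n c) (tensor_id E) (emb f))) = (\<lambda>z. \<mu> * emb f z)" for f
    by (subst emb_cong[OF key]) (auto simp: emb_def)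
  then show "\<exists>\<mu>. \<forall>v\<in>states (ea_basis n c).
      apply_op (ea_basis n c) proj (apply_op (ea_basis n c) (tensor_id E)
        (apply_op (ea_basis n c) proj v))
      = (\<lambda>z. \<mu> * apply_op (ea_basis n c) proj v z)"
    unfolding apply_proj by blast
qed

section \<open>The isometric encoder and its image\<close>

definition enc :: "'a vec \<Rightarrow> 'a vec \<times> 'a vec \<Rightarrow> complex" where
  "enc x = (\<lambda>(m, s). if x = g m + W s then 1 else 0)"

lemma g_D: "m \<in> carrier_vec k \<Longrightarrow> g m \<in> D"
  using g by (auto simp: bij_betw_def)

text \<open>Multiplication by K removes the words g m and g m', leaving K W (s - s') = 0;
  nondegeneracy gives s = s', and injectivity of g the rest.\<close>

lemma inj_on_encoding: "inj_on (\<lambda>(m, s). g m + W s) (carrier_vec k \<times> carrier_vec c)"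
proof (rule inj_onI, clarify)
  fix m s m' s' :: "'a vec"
  assume *: "m \<in> carrier_vec k" "s \<in> carrier_vec c" "m' \<in> carrier_vec k" "s' \<in> carrier_vec c"
    and eq: "g m + W s = g m' + W s'"
  have gm: "g m \<in> carrier_vec n" "g m' \<in> carrier_vec n" "K *\<^sub>v g m = 0\<^sub>v c" "K *\<^sub>v g m' = 0\<^sub>v c"
    using * g_D D_carrier D_iff by blast+
  have "W (s - s') = g m' - g m"
  proof (rule eq_vecI)
    fix i assume "i < dim_vec (g m' - g m)"
    then have i: "i < n"
      using gm by simp
    have "(g m + W s) $ i = (g m' + W s') $ i"
      by (simp only: eq)
    then have "g m $ i + W s $ i = g m' $ i + W s' $ i"
      using i by simp
    then show "W (s - s') $ i = (g m' - g m) $ i"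
      using i gm * by (simp add: W_minus algebra_simps)
  qed (use gm in simp)
  then have "K *\<^sub>v W (s - s') = 0\<^sub>v c"
    using gm by (simp add: mult_minus_distrib_mat_vec[OF K])
  then have s0: "s - s' = 0\<^sub>v c"
    by (rule nondegenerate[OF minus_carrier_vec[OF *(2,4)]])
  have s: "s = s'"
  proof (rule eq_vecI)
    fix i assume "i < dim_vec s'"
    then show "s $ i = s' $ i"
      using arg_cong[OF s0, of "\<lambda>v. v $ i"] * by simp
  qed (use * in simp)
  have "g m = g m'"
  proof (rule eq_vecI)
    fix i assume "i < dim_vec (g m')"
    then show "g m $ i = g m' $ i"
      using arg_cong[OF eq, of "\<lambda>v. v $ i"] gm s by simp
  qed (use gm in simp)
  then have "m = m'"
    using * g by (auto simp: bij_betw_def dest: inj_onD)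
  with s show "m = m' \<and> s = s'"
    by simp
qed

text \<open>Basis states go to basis states, and injectivity keeps them distinct.\<close>

lemma enc_isometry: "is_isometry (carrier_vec k \<times> carrier_vec c) (carrier_vec n) enc"
  unfolding is_isometry_def
proof (intro ballI)
  fix a b :: "'a vec \<times> 'a vec"
  assume a: "a \<in> carrier_vec k \<times> carrier_vec c" and b: "b \<in> carrier_vec k \<times> carrier_vec c"
  let ?\<phi> = "\<lambda>(m, s). g m + W s"
  have enc: "enc x e = (if x = ?\<phi> e then 1 else 0)" for x e
    by (simp add: enc_def split: prod.split)
  have "?\<phi> b \<in> carrier_vec n"
    using b g_D D_carrier by auto
  then have "(\<Sum>x\<in>carrier_vec n. cnj (enc x a) * enc x b)
      = (\<Sum>x\<in>carrier_vec n. if x = ?\<phi> b then (if ?\<phi> b = ?\<phi> a then 1 else 0) else 0)"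
    by (intro sum.cong) (auto simp: enc)
  also have "\<dots> = (if ?\<phi> b = ?\<phi> a then 1 else 0)"
    using \<open>?\<phi> b \<in> carrier_vec n\<close> by (simp add: sum.delta)
  also have "\<dots> = (if a = b then 1 else 0)"
    using inj_on_eq_iff[OF inj_on_encoding b a] by auto
  finally show "(\<Sum>x\<in>carrier_vec n. cnj (enc x a) * enc x b) = (if a = b then 1 else 0)" .
qed

lemma max_entangled_state_eq:
  fixes s t :: "'a vec"
  assumes "s \<in> carrier_vec c" "t \<in> carrier_vec c"
  shows "max_entangled_state c (s, t)
    = (if s = t then complex_of_real (1 / sqrt (real CARD('a))) ^ c else 0)"
proof (cases "s = t")
  case False
  then obtain i where "i < c" "s $ i \<noteq> t $ i"
    using assms by (auto simp: vec_eq_iff)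
  then have "(\<Prod>i<c. if s $ i = t $ i then complex_of_real (1 / sqrt (real CARD('a))) else 0) = 0"
    by (intro prod_zero) auto
  moreover have "max_entangled_state c (s, t)
      = (\<Prod>i<c. if s $ i = t $ i then complex_of_real (1 / sqrt (real CARD('a))) else 0)"
    using assms by (simp only: max_entangled_state_def prod.case mem_Sigma_iff simp_thms if_True)
  ultimately show ?thesis
    using False by argo
qed (use assms in \<open>simp add: max_entangled_state_def\<close>)

text \<open>The entangled pairs force s = t with amplitude q^(-c/2), and then the only message that
  contributes is the preimage of x - W t under g. Outside \<open>D\<close> the value of
  \<open>inv_into\<close> is arbitrary, but \<open>emb\<close> ignores it.\<close>

lemma ea_encode_eq:
  "ea_encode n k c enc \<psi>
    = emb (\<lambda>z. \<psi> (inv_into (carrier_vec k) g z) * complex_of_real (1 / sqrt (real CARD('a))) ^ c)"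
proof (rule ext, clarify)
  fix x t :: "'a vec"
  let ?\<kappa> = "complex_of_real (1 / sqrt (real CARD('a))) ^ c"
  let ?r = "emb (\<lambda>z. \<psi> (inv_into (carrier_vec k) g z) * ?\<kappa>)"
  show "ea_encode n k c enc \<psi> (x, t) = ?r (x, t)"
  proof (cases "(x, t) \<in> ea_basis n c")
    case True
    then have x: "x \<in> carrier_vec n" and t: "t \<in> carrier_vec c"
      by auto
    have "ea_encode n k c enc \<psi> (x, t)
        = (\<Sum>(m, s)\<in>carrier_vec k \<times> carrier_vec c. if s = t then enc x (m, t) * (\<psi> m * ?\<kappa>) else 0)"
      using x t by (auto simp: ea_encode_def max_entangled_state_eq intro!: sum.cong)
    also have "\<dots> = (\<Sum>m\<in>carrier_vec k. \<Sum>s\<in>carrier_vec c. if s = t then enc x (m, t) * (\<psi> m * ?\<kappa>) else 0)"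
      by (rule sum.cartesian_product[symmetric])
    also have "\<dots> = (\<Sum>m\<in>carrier_vec k. enc x (m, t) * (\<psi> m * ?\<kappa>))"
      using t by (simp add: sum.delta)
    also have "\<dots> = (\<Sum>m\<in>carrier_vec k. if g m = x - W t then \<psi> m * ?\<kappa> else 0)"
    proof (rule sum.cong[OF refl])
      fix m :: "'a vec" assume "m \<in> carrier_vec k"
      then have "x = g m + W t \<longleftrightarrow> g m = x - W t"
        using minus_W_eq_iff[OF x D_carrier[OF g_D]] by metis
      then show "enc x (m, t) * (\<psi> m * ?\<kappa>) = (if g m = x - W t then \<psi> m * ?\<kappa> else 0)"
        by (simp add: enc_def)
    qed
    also have "\<dots> = ?r (x, t)"
    proof (cases "x - W t \<in> D")
      case in_D: True
      let ?m = "inv_into (carrier_vec k) g (x - W t)"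
      have m: "?m \<in> carrier_vec k" "g ?m = x - W t"
        using in_D g by (auto simp: bij_betw_def inv_into_into f_inv_into_f)
      have "g m = x - W t \<longleftrightarrow> m = ?m" if "m \<in> carrier_vec k" for m
        using m that g by (metis bij_betw_inv_into_left)
      then have "(\<Sum>m\<in>carrier_vec k. if g m = x - W t then \<psi> m * ?\<kappa> else 0)
          = (\<Sum>m\<in>carrier_vec k. if m = ?m then \<psi> m * ?\<kappa> else 0)"
        by (intro sum.cong) auto
      then show ?thesis
        using m in_D True by (simp add: sum.delta emb_def)
    next
      case False
      then have "g m \<noteq> x - W t" if "m \<in> carrier_vec k" for m
        using g_D[OF that] by auto
      then show ?thesis
        using False by (auto simp: emb_def)
    qed
    finally show ?thesis .
  qed (auto simp: ea_encode_def emb_def)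
qed

lemma ea_encode_image: "ea_encode n k c enc ` states (carrier_vec k) = range emb"
proof (rule subset_antisym; rule subsetI)
  fix v assume "v \<in> range emb"
  then obtain f where v: "v = emb f"
    by blast
  let ?\<kappa> = "complex_of_real (1 / sqrt (real CARD('a))) ^ c"
  \<comment> \<open>Division by \<open>?\<kappa>\<close> undoes the amplitude of the entangled
    pairs.\<close>
  define \<psi> where "\<psi> m = (if m \<in> carrier_vec k then f (g m) / ?\<kappa> else 0)" for m
  have "\<psi> \<in> states (carrier_vec k)"
    by (simp add: states_def \<psi>_def)
  moreover have "ea_encode n k c enc \<psi> = v"
    unfolding ea_encode_eq v
    using g by (intro emb_cong) (auto simp: \<psi>_def bij_betw_def inv_into_into f_inv_into_f)
  ultimately show "v \<in> ea_encode n k c enc ` states (carrier_vec k)"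
    by blast
qed (auto simp: ea_encode_eq)

lemma is_eaqecc: "is_eaqecc n k d c (range emb)"
  unfolding is_eaqecc_def using enc_isometry ea_encode_image has_distance by blast

section \<open>The stabilizer description of the code space\<close>

abbreviation A :: "'a mat" where
  "A \<equiv> 1\<^sub>m c"

text \<open>With \<open>A\<close> the identity, the commutation condition H K^T + A B^T = 0 leaves
  only this choice.\<close>

abbreviation B :: "'a mat" where
  "B \<equiv> - (K * H\<^sup>T)"

text \<open>Moving the transposes across the scalar products merges both phases into one that
  depends only on the syndrome of x - W t under K, hence is constant on the orbits of the X-type
  stabilizers.\<close>

lemma Z_exponent:
  assumes "w \<in> carrier_vec c" "x \<in> carrier_vec n" "t \<in> carrier_vec c"
  shows "(K\<^sup>T *\<^sub>v w) \<bullet> x + (B\<^sup>T *\<^sub>v w) \<bullet> t = w \<bullet> (K *\<^sub>v (x - W t))"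
proof -
  have KH: "K * H\<^sup>T \<in> carrier_mat c c" and B: "B \<in> carrier_mat c c"
    using H K by auto
  have "(B\<^sup>T *\<^sub>v w) \<bullet> t = w \<bullet> (B *\<^sub>v t)"
    using assms B by (simp add: transpose_vec_mult_scalar)
  also have "B *\<^sub>v t = - (K *\<^sub>v W t)"
    using assms H K KH by (simp add: uminus_mult_mat_vec)
  finally show ?thesis
    using assms K by (simp add: transpose_vec_mult_scalar mult_minus_distrib_mat_vec[OF K]
        scalar_prod_minus_distrib[of _ c])
qed

text \<open>A shift by (W u, u) does not change x - W t, and on the support the syndrome is 0, where
  every character equals 1.\<close>

lemma emb_stabilized: "emb f \<in> css_code_space n c H K A B"
  unfolding css_code_space_def
proof (intro CollectI conjI ballI allI impI)
  show "emb f \<in> states (ea_basis n c)"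
    by (auto simp: states_def emb_def)
next
  fix u :: "'a vec" assume "u \<in> carrier_vec (dim_row H)"
  then have u: "u \<in> carrier_vec c"
    by simp
  have "X_op n c (W u) (A\<^sup>T *\<^sub>v u) (emb f) (x, t) = emb f (x, t)" for x t
  proof (cases "(x, t) \<in> ea_basis n c")
    case True
    then have "(x - W u) - W (t - u) = x - W t"
      using u by (auto simp: W_minus intro!: eq_vecI)
    then show ?thesis
      using u True by (simp add: X_op_def emb_def)
  qed (auto simp: X_op_def emb_def)
  then show "X_op n c (W u) (A\<^sup>T *\<^sub>v u) (emb f) = emb f"
    by auto
next
  fix w :: "'a vec" and \<chi> :: "'a \<Rightarrow> complex"
  assume "w \<in> carrier_vec (dim_row K)" and \<chi>: "additive_character \<chi>"
  then have w: "w \<in> carrier_vec c"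
    by simp
  have "Z_op n c \<chi> (K\<^sup>T *\<^sub>v w) (B\<^sup>T *\<^sub>v w) (emb f) (x, t) = emb f (x, t)" for x t
  proof (cases "(x, t) \<in> ea_basis n c \<and> x - W t \<in> D")
    case True
    then have "K *\<^sub>v (x - W t) = 0\<^sub>v c"
      using D_carrier D_iff by blast
    then have "\<chi> ((K\<^sup>T *\<^sub>v w) \<bullet> x + (B\<^sup>T *\<^sub>v w) \<bullet> t) = 1"
      using True \<chi> w by (subst Z_exponent) (auto simp: additive_character_def)
    then show ?thesis
      using True by (simp add: Z_op_def)
  qed (auto simp: Z_op_def emb_def)
  then show "Z_op n c \<chi> (K\<^sup>T *\<^sub>v w) (B\<^sup>T *\<^sub>v w) (emb f) = emb f"
    by auto
qed

lemma css_code_space_subset: "css_code_space n c H K A B \<subseteq> range emb"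
proof
  fix v assume v: "v \<in> css_code_space n c H K A B"
  have X: "X_op n c (W u) (A\<^sup>T *\<^sub>v u) v = v" if "u \<in> carrier_vec c" for u
    using v that by (simp add: css_code_space_def)
  have Z: "Z_op n c \<chi> (K\<^sup>T *\<^sub>v w) (B\<^sup>T *\<^sub>v w) v = v"
    if "w \<in> carrier_vec c" "additive_character \<chi>" for w \<chi>
    using v that by (simp add: css_code_space_def)
  have "v (x, t) = emb (\<lambda>z. v (z, 0\<^sub>v c)) (x, t)" for x t
  proof (cases "(x, t) \<in> ea_basis n c")
    case False
    then show ?thesis
      using v by (auto simp: css_code_space_def states_def emb_def)
  next
    case True
    then have x: "x \<in> carrier_vec n" and t: "t \<in> carrier_vec c"
      by auto
    show ?thesis
    proof (cases "x - W t \<in> D")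
      case in_D: True
      \<comment> \<open>The X-type stabilizer with u = t moves every amplitude back to receiver
        label 0.\<close>
      have "v (x, t) = v (x - W t, t - t)"
        using fun_cong[OF X[OF t], of "(x, t)"] x t by (simp add: X_op_def)
      also have "t - t = 0\<^sub>v c"
        using t by simp
      finally show ?thesis
        using x t in_D by (simp add: emb_def)
    next
      case False
      then have "K *\<^sub>v (x - W t) \<noteq> 0\<^sub>v c"
        using x by (simp add: D_iff)
      then obtain i where i: "i < c" "(K *\<^sub>v (x - W t)) $ i \<noteq> 0"
        by (auto simp: vec_eq_iff)
      \<comment> \<open>A nonzero syndrome entry, selected by a unit vector, gets a phase other than
        1; invariance then forces the amplitude to be 0.\<close>
      obtain \<chi> :: "'a \<Rightarrow> complex" where \<chi>: "additive_character \<chi>"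
        "\<chi> ((K *\<^sub>v (x - W t)) $ i) \<noteq> 1"
        using additive_character_separates[OF i(2)] by blast
      have "unit_vec c i \<bullet> (K *\<^sub>v (x - W t)) = (K *\<^sub>v (x - W t)) $ i"
        using i by (intro scalar_prod_left_unit) (auto intro: carrier_vecI)
      then have "\<chi> ((K *\<^sub>v (x - W t)) $ i) * v (x, t) = v (x, t)"
        using fun_cong[OF Z[OF unit_vec_carrier \<chi>(1)], of i "(x, t)"] x t
        by (simp add: Z_op_def Z_exponent)
      then have "v (x, t) = 0"
        using \<chi>(2) by simp
      then show ?thesis
        using False by (simp add: emb_def)
    qed
  qed
  then have "v = emb (\<lambda>z. v (z, 0\<^sub>v c))"
    by (intro ext) (metis surj_pair)
  then show "v \<in> range emb"
    by blast
qed

lemma css_construction: "css_construction n c H K (range emb)"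
proof -
  have HK: "H * K\<^sup>T \<in> carrier_mat c c"
    using H K by simp
  have "A * B\<^sup>T = - (H * K\<^sup>T)"
    using H K HK by (simp add: transpose_mult[OF K] transpose_uminus)
  then have "H * K\<^sup>T + A * B\<^sup>T = 0\<^sub>m (dim_row H) (dim_row K)"
    using HK by (auto intro!: eq_matI)
  moreover have "range emb = css_code_space n c H K A B"
    using emb_stabilized css_code_space_subset by (intro subset_antisym) auto
  moreover have "A \<in> carrier_mat (dim_row H) c" "B \<in> carrier_mat (dim_row K) c"
    using H K by simp_all
  ultimately show ?thesis
    unfolding css_construction_def by blast
qed

end

section \<open>The codes spanned by rows of the Fourier matrix\<close>

context primitive_root_finite
begin

section \<open>Arbitrary check matrices of the two codes\<close>

context
  fixes r :: nat and H K :: "'a mat"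
  assumes r: "1 \<le> r" "r < n"
    and H: "H \<in> carrier_mat (n - r) n" "mat_kernel H = rs_code 0 r"
    and K: "K \<in> carrier_mat (n - r) n" "mat_kernel K = rs_code (n - r + 1) r"
begin

lemma transpose_check_eq_0:
  "u \<in> carrier_vec (n - r) \<Longrightarrow> H\<^sup>T *\<^sub>v u = 0\<^sub>v n \<Longrightarrow> u = 0\<^sub>v (n - r)"
  using transpose_mult_vec_eq_0[OF H(1) check_matrix_mult_surj[OF _ _ H]] r by simp

lemma transpose_check_orthogonal:
  assumes "u \<in> carrier_vec (n - r)" "i < r"
  shows "eval_vec 0 (monom 1 i) \<bullet> (H\<^sup>T *\<^sub>v u) = 0"
proof -
  let ?y = "eval_vec 0 (monom 1 i)"
  have "?y \<in> mat_kernel H"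
    using assms(2) unfolding H(2) rs_code_def by (intro imageI) (simp add: degree_monom_eq)
  then have "H *\<^sub>v ?y = 0\<^sub>v (n - r)"
    using mat_kernelD[OF H(1)] by blast
  then have "(H\<^sup>T *\<^sub>v u) \<bullet> ?y = 0"
    using transpose_vec_mult_scalar[OF H(1) _ assms(1), of ?y] assms(1) by simp
  moreover have "H\<^sup>T *\<^sub>v u \<in> carrier_vec n"
    using H(1) assms(1) by simp
  ultimately show ?thesis
    using comm_scalar_prod[of ?y n "H\<^sup>T *\<^sub>v u"] by simp
qed

text \<open>The words H^T u are orthogonal to the monomial basis of the first code, so they lie in
  its dual; H^T is injective, and counting gives equality.\<close>

lemma transpose_check_image: "(\<lambda>u. H\<^sup>T *\<^sub>v u) ` carrier_vec (n - r) = rs_code 1 (n - r)"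
proof (rule card_subset_eq)
  have "rs_code 1 (n - r) = {x \<in> carrier_vec n. \<forall>i<r. eval_vec 0 (monom 1 i) \<bullet> x = 0}"
    using rs_code_dual[of "n - r" 0 1] r by simp
  then show "(\<lambda>u. H\<^sup>T *\<^sub>v u) ` carrier_vec (n - r) \<subseteq> rs_code 1 (n - r)"
    using transpose_check_orthogonal H(1) by auto
  show "finite (rs_code 1 (n - r))"
    by (rule finite_subset[OF _ finite_carrier_vec[of n]]) (auto simp: rs_code_def)
  have "inj_on (\<lambda>u. H\<^sup>T *\<^sub>v u) (carrier_vec (n - r))"
  proof (rule inj_onI)
    fix u v :: "'a vec" assume uv: "u \<in> carrier_vec (n - r)" "v \<in> carrier_vec (n - r)"
      and eq: "H\<^sup>T *\<^sub>v u = H\<^sup>T *\<^sub>v v"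
    have Hv: "H\<^sup>T *\<^sub>v v \<in> carrier_vec n"
      using H(1) uv by simp
    have "H\<^sup>T *\<^sub>v (u - v) = H\<^sup>T *\<^sub>v u - H\<^sup>T *\<^sub>v v"
      using H(1) uv by (intro mult_minus_distrib_mat_vec[of _ n "n - r"]) auto
    also have "\<dots> = 0\<^sub>v n"
      using Hv by (simp add: eq)
    finally have 0: "u - v = 0\<^sub>v (n - r)"
      by (rule transpose_check_eq_0[OF minus_carrier_vec[OF uv]])
    show "u = v"
    proof (rule eq_vecI)
      fix i assume "i < dim_vec v"
      then show "u $ i = v $ i"
        using arg_cong[OF 0, of "\<lambda>v. v $ i"] uv by simp
    qed (use uv in simp)
  qed
  then show "card ((\<lambda>u. H\<^sup>T *\<^sub>v u) ` carrier_vec (n - r)) = card (rs_code 1 (n - r))"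
    using r by (simp add: card_image card_carrier_vec card_rs_code)
qed

text \<open>Here H^T u lies in the second code and is orthogonal to the first. Pairing it with the r
  monomial words of the first code reads off all r coefficients of its polynomial, which therefore
  vanish.\<close>

lemma check_product_nondegenerate:
  assumes u: "u \<in> carrier_vec (n - r)" and 0: "K *\<^sub>v (H\<^sup>T *\<^sub>v u) = 0\<^sub>v (n - r)"
  shows "u = 0\<^sub>v (n - r)"
proof -
  have "H\<^sup>T *\<^sub>v u \<in> mat_kernel K"
    using H(1) K(1) u 0 by (intro mat_kernelI[OF K(1)]) auto
  then obtain p where p: "degree p < r" "H\<^sup>T *\<^sub>v u = eval_vec (n - r + 1) p"
    unfolding K(2) rs_code_def by blast
  have "coeff p l = 0" for l
  proof (cases "l < r")
    case True
    \<comment> \<open>The degree r - 1 - l is the one for which (r - 1 - l) + (n - r + 1) + l equals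
      n.\<close>
    have "of_nat n * coeff p l
        = eval_vec 0 (monom 1 (r - 1 - l)) \<bullet> eval_vec (n - r + 1) p"
      using True p(1) r by (intro eval_vec_monom_scalar_prod[symmetric]) auto
    also have "\<dots> = 0"
      using transpose_check_orthogonal[OF u, of "r - 1 - l"] r p(2) by simp
    finally show ?thesis
      using of_nat_n_nonzero by simp
  qed (use p(1) in \<open>simp add: coeff_eq_0\<close>)
  then have "p = 0"
    by (intro poly_eqI) simp
  then show ?thesis
    using p(2) transpose_check_eq_0[OF u] by (simp add: eval_vec_0)
qed

text \<open>K H^T is square with trivial kernel, and H K^T is its transpose.\<close>

lemma rank_check_product: "vec_space.rank (n - r) (H * K\<^sup>T) = n - r"
proof -
  have HK: "H * K\<^sup>T \<in> carrier_mat (n - r) (n - r)" "K * H\<^sup>T \<in> carrier_mat (n - r) (n - r)"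
    using H(1) K(1) by simp_all
  have "(K * H\<^sup>T) *\<^sub>v u = K *\<^sub>v (H\<^sup>T *\<^sub>v u)" if "u \<in> carrier_vec (n - r)" for u
    using H(1) K(1) that by (intro assoc_mult_mat_vec[of _ _ n _ "n - r"]) auto
  then have "det (K * H\<^sup>T) \<noteq> 0"
    using det_0_iff_vec_prod_zero_field[OF HK(2)] check_product_nondegenerate by auto
  moreover have "(H * K\<^sup>T)\<^sup>T = K * H\<^sup>T"
    using transpose_mult[OF H(1), of "K\<^sup>T" "n - r"] K(1) by simp
  ultimately have "det (H * K\<^sup>T) \<noteq> 0"
    using det_transpose[OF HK(1)] by simp
  then show ?thesis
    using vec_space.det_rank_iff[OF HK(1)] by simp
qed

lemma ea_css_check_matrices:
  "ea_css n r (n - r) (n - r + 1) H K (\<lambda>m. gen_mat (n - r + 1) r *\<^sub>v m)"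
proof (rule ea_css.intro)
  show "bij_betw (\<lambda>m. gen_mat (n - r + 1) r *\<^sub>v m) (carrier_vec r) (mat_kernel K)"
    unfolding K(2) bij_betw_def using r inj_on_gen_mat rs_code_eq_image by simp
next
  fix z assume z: "z \<in> mat_kernel K" "z \<noteq> 0\<^sub>v n"
  have "0\<^sub>v n \<in> rs_code (n - r + 1) r"
    unfolding rs_code_def using r by (intro image_eqI[where x = 0]) (simp_all add: eval_vec_0)
  then have "n - r + 1 \<le> hamming_dist z (0\<^sub>v n)"
    using z r unfolding K(2) by (intro rs_code_distance_ge) auto
  also have "hamming_dist z (0\<^sub>v n) = card {i. i < n \<and> z $ i \<noteq> 0}"
  proof -
    have "dim_vec z = n"
      using mat_kernelD(1)[OF K(1) z(1)] by simp
    then show ?thesis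
      unfolding hamming_dist_def by (intro arg_cong[where f = card]) auto
  qed
  finally show "n - r + 1 \<le> card {i. i < n \<and> z $ i \<noteq> 0}" .
next
  fix S :: "nat set" and z :: "'a vec"
  assume "S \<subseteq> {..<n}" "card S < n - r + 1"
  \<comment> \<open>At most n - r positions are prescribed, the number that this code leaves
    free.\<close>
  then have "\<exists>y\<in>rs_code 1 (n - r). \<forall>j\<in>S. y $ j = z $ j"
    using r by (intro exists_eval_vec_on) auto
  then show "\<exists>u\<in>carrier_vec (n - r). \<forall>j\<in>S. (H\<^sup>T *\<^sub>v u) $ j = z $ j"
    unfolding transpose_check_image[symmetric] by blast
qed (use H(1) K(1) check_product_nondegenerate in auto)

lemma exists_css_eaqecc:
  "\<exists>Q. css_construction n (n - r) H K Q \<and> is_eaqecc n r (n - r + 1) (n - r) Q"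
  using ea_css.css_construction[OF ea_css_check_matrices]
    ea_css.is_eaqecc[OF ea_css_check_matrices] by blast

end

section \<open>Blocks of rows of the Fourier matrix\<close>

lemma row_fourier_mat: "row (fourier_mat n \<omega>) ((s + i) mod n) = eval_vec s (monom 1 i)"
proof (rule eq_vecI)
  fix l assume "l < dim_vec (eval_vec s (monom 1 i))"
  then have l: "l < n"
    by simp
  then have "row (fourier_mat n \<omega>) ((s + i) mod n) $ l = (\<omega> ^ ((s + i) mod n)) ^ l"
    by (simp add: fourier_mat_def power_mult)
  also have "\<dots> = eval_vec s (monom 1 i) $ l"
    using l by (simp add: root_power_mod poly_monom algebra_simps flip: power_mult power_add)
  finally show "row (fourier_mat n \<omega>) ((s + i) mod n) $ l = eval_vec s (monom 1 i) $ l" .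
qed (simp add: fourier_mat_def)

text \<open>Indices modulo n let a block of rows wrap around, as it does for D, whose block ends
  with row 0.\<close>

lemma span_rows_fourier_mat:
  assumes "0 < k"
  shows "module.span class_ring (module_vec TYPE('a) n)
    (row (fourier_mat n \<omega>) ` (\<lambda>i. (s + i) mod n) ` {..<k}) = rs_code s k"
  by (simp only: image_image row_fourier_mat span_eval_vec_monom[OF assms])

end

theorem mainTheorem1:
  fixes n r q :: nat and \<omega> :: "'a :: {field, finite}"
    and e :: "nat \<Rightarrow> 'a vec" and C D :: "'a vec set"
  assumes "1 \<le> r" and "r < n"
    and "primepow q" and "CARD('a) = q"
    and "primitive_root_of_unity n \<omega>"
    and "e = row (fourier_mat n \<omega>)"
    and "C = module.span class_ring (module_vec TYPE('a) n) (e ` {0..r - 1})"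
    and "D = module.span class_ring (module_vec TYPE('a) n) (e ` ({n - r + 1..n - 1} \<union> {0}))"
  shows "let c = n - r; d = n - r + 1; k = 2 * r + c - n in
    int k = 2 * int r - int n + int c \<and>
    linear_code n r d C \<and> linear_code n r d D \<and>
    (\<exists>H. check_matrix n r H C) \<and> (\<exists>K. check_matrix n r K D) \<and>
    (\<forall>H K. check_matrix n r H C \<and> check_matrix n r K D \<longrightarrow>
       vec_space.rank (n - r) (H * K\<^sup>T) = c \<and>
       (\<exists>Q. css_construction n c H K Q \<and> is_eaqecc n k d c Q)) \<and>
    maximum_entanglement n k c"
proof -
  interpret primitive_root_finite n \<omega>
    using assms by unfold_locales auto
  have "{0..r - 1} = (\<lambda>i. (0 + i) mod n) ` {..<r}"
  proof -
    have "(\<lambda>i. (0 + i) mod n) ` {..<r} = (\<lambda>i. i) ` {..<r}"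
      using assms(2) by (intro image_cong) auto
    then show ?thesis
      using assms(1) by auto
  qed
  then have C: "C = rs_code 0 r"
    using span_rows_fourier_mat[of r 0] assms(1) unfolding assms(6,7) by simp
  \<comment> \<open>The r rows from n - r + 1 on are cyclically consecutive; the last one, i = r -
    1, has index n and wraps to 0.\<close>
  have "{n - r + 1..n - 1} \<union> {0} = (\<lambda>i. (n - r + 1 + i) mod n) ` {..<r}"
  proof (rule subset_antisym; rule subsetI)
    fix j assume j: "j \<in> {n - r + 1..n - 1} \<union> {0}"
    show "j \<in> (\<lambda>i. (n - r + 1 + i) mod n) ` {..<r}"
    proof (cases "j = 0")
      case True
      then show ?thesis
        using assms(1,2) by (intro image_eqI[of _ _ "r - 1"]) auto
    next
      case False
      then show ?thesis
        using j assms(1,2) by (intro image_eqI[of _ _ "j - (n - r + 1)"]) auto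
    qed
  next
    fix j assume "j \<in> (\<lambda>i. (n - r + 1 + i) mod n) ` {..<r}"
    then obtain i where i: "i < r" "j = (n - r + 1 + i) mod n"
      by blast
    show "j \<in> {n - r + 1..n - 1} \<union> {0}"
    proof (cases "i = r - 1")
      case True
      then have "n - r + 1 + i = n"
        using assms(1,2) by simp
      then show ?thesis
        using i by simp
    next
      case False
      then have "n - r + 1 + i < n"
        using i(1) assms(2) by linarith
      then show ?thesis
        using i by simp
    qed
  qed
  then have D: "D = rs_code (n - r + 1) r"
    using span_rows_fourier_mat[of r "n - r + 1"] assms(1) unfolding assms(6,8) by simp
  \<comment> \<open>The subtraction does not truncate, since 2 r + (n - r) = n + r.\<close>
  have k: "2 * r + (n - r) - n = r"
    using assms(2) by simp
  \<comment> \<open>The Fourier rows r, ..., n - 1 form a check matrix of D; for C the rows 1, ...,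
    n - r do, as 1 + 0 + (n - 1) = n.\<close>
  have "n dvd r + (n - r + 1) + (n - 1)"
  proof -
    have "r + (n - r + 1) + (n - 1) = 2 * n"
      using assms(2) by simp
    then show ?thesis
      by simp
  qed
  then have "\<exists>K. check_matrix n r K D"
    unfolding D using assms(1,2) by (intro exists_check_matrix[of r r]) auto
  moreover have "\<exists>H. check_matrix n r H C"
    unfolding C using assms(1,2) by (intro exists_check_matrix[of r 1]) auto
  moreover have "linear_code n r (n - r + 1) C" "linear_code n r (n - r + 1) D"
    unfolding C D using assms(1,2) by (intro linear_code_rs_code; simp)+
  moreover have "vec_space.rank (n - r) (H * K\<^sup>T) = n - r
      \<and> (\<exists>Q. css_construction n (n - r) H K Q \<and> is_eaqecc n r (n - r + 1) (n - r) Q)"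
    if "check_matrix n r H C" "check_matrix n r K D" for H K
    using that assms(1,2) rank_check_product[of r H K] exists_css_eaqecc[of r H K]
    unfolding check_matrix_def C D by metis
  moreover have "int r = 2 * int r - int n + int (n - r)" "maximum_entanglement n r (n - r)"
    using assms(2) by (simp_all add: maximum_entanglement_def)
  ultimately show ?thesis
    unfolding Let_def k by blast
qed

end
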